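(* Let $\mathcal G$ be a locally compact second countable amenable group. Assume that $(\Phi_N)$ is a tempered strong F\o{}lner sequence in $\mathcal G$ and that $c\in L^\infty(\mathcal G)$, real-valued and bounded by $1$, satisfies the following condition: for every $\delta>0$ there exists $N_\delta\in\mathbb N$ such that for all $N_\delta\leq L\leq R$ \[ \underline d\Big(\Big\{a\in\mathcal G:\ \forall\,L\leq n\leq R\quad \big|\mathbb E_{g\in\Phi_n}c(g)c(ga)\big|<\delta\Big\}\Big)>1-\delta . \] Then for every ergodic measure-preserving system $(X,\mathcal G)$ and every $f\in L^\infty(X)$ we have \[ \lim_{N\to\infty}\mathbb E_{g\in\Phi_N}c(g)f(gx)=0\qquad\text{for a.e. }x\in X. \]
   Context: $|\cdot|$ is the left Haar measure on $\mathcal G$, and $\mathbb E_{g\in\Phi}h(g)=\frac1{|\Phi|}\int_{g\in\Phi}h(g)$. The lower density (along $(\Phi_N)$) of $S\subset\mathcal G$ is $\underline d(S)=\liminf_N|S\cap\Phi_N|/|\Phi_N|$. A measure-preserving system $(X,\mathcal G)$ is a probability space with a measurable measure-preserving action of $\mathcal G$. A sequence of sets $\Phi_n\subset\mathcal G$ is a strong F\o{}lner sequence if for every compact $K\subset\mathcal G$ one has $|\partial_K(\Phi_n)|/|\Phi_n|\to0$, where $\partial_K(\Phi)=K^{-1}\Phi\cap K^{-1}\Phi^{\complement}$. It is ($C$-)tempered if there is a constant $C$ such that $|\bigcup_{i<j}\Phi_i^{-1}\Phi_j|<C|\Phi_j|$ for every $j$. *)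

theory Defs
  imports "HOL-Probability.Probability"
begin

text \<open>
  Groups are rendered by the library class \<open>topological_group_add\<close>. That class does not assume
  commutativity: the group product \<open>gh\<close> is written \<open>g + h\<close>, the inverse of \<open>g\<close> is written
  \<open>- g\<close> and the neutral element is \<open>0\<close>.
\<close>

text \<open>
  Regularity of the Haar measure is not listed, because every Borel measure that is finite on
  compact sets is regular on a locally compact second countable Hausdorff space.
\<close>

definition left_haar_measure ::
  "'g::{topological_group_add, second_countable_topology, t2_space} measure \<Rightarrow> bool" where
  "left_haar_measure \<mu> \<longleftrightarrow>
     sets \<mu> = sets borel \<and>
     emeasure \<mu> UNIV \<noteq> 0 \<and>
     (\<forall>K. compact K \<longrightarrow> emeasure \<mu> K < \<infinity>) \<and>
     (\<forall>g. \<forall>A\<in>sets borel. emeasure \<mu> ((\<lambda>h. g + h) ` A) = emeasure \<mu> A)"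

text \<open>The set of representatives of elements of \<open>L\<^sup>\<infinity>(M)\<close>; functions are not identified a.e.\<close>

definition Linfty :: "'a measure \<Rightarrow> ('a \<Rightarrow> 'b::real_normed_vector) set" where
  "Linfty M = {f \<in> borel_measurable M. \<exists>B. AE x in M. norm (f x) \<le> B}"

text \<open>
  Amenability: existence of a left invariant mean on real \<open>L\<^sup>\<infinity>(\<mu>)\<close>. As positivity is required
  for functions that are nonnegative a.e., additivity makes \<open>m\<close> depend on the a.e.-class only.
\<close>

definition amenable ::
  "'g::{topological_group_add, second_countable_topology, t2_space} measure \<Rightarrow> bool" where
  "amenable \<mu> \<longleftrightarrow>
     (\<exists>m :: ('g \<Rightarrow> real) \<Rightarrow> real.
        (\<forall>f\<in>Linfty \<mu>. \<forall>h\<in>Linfty \<mu>. m (\<lambda>x. f x + h x) = m f + m h) \<and>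
        (\<forall>r. \<forall>f\<in>Linfty \<mu>. m (\<lambda>x. r * f x) = r * m f) \<and>
        (\<forall>f\<in>Linfty \<mu>. (AE x in \<mu>. 0 \<le> f x) \<longrightarrow> 0 \<le> m f) \<and>
        m (\<lambda>x. 1) = 1 \<and>
        (\<forall>g. \<forall>f\<in>Linfty \<mu>. m (\<lambda>x. f (g + x)) = m f))"

definition inv_prod :: "'g::group_add set \<Rightarrow> 'g set \<Rightarrow> 'g set" where
  "inv_prod A B = {- a + b | a b. a \<in> A \<and> b \<in> B}"  \<comment> \<open>\<open>A\<inverse>B\<close>\<close>

definition group_boundary :: "'g::group_add set \<Rightarrow> 'g set \<Rightarrow> 'g set" where
  "group_boundary K \<Phi> = inv_prod K \<Phi> \<inter> inv_prod K (- \<Phi>)"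

text \<open>
  The conditions that each \<open>\<Phi> n\<close> is measurable with \<open>0 < \<bar>\<Phi> n\<bar> < \<infinity>\<close> are what
  the quotients by \<open>\<bar>\<Phi> n\<bar>\<close> need. For Borel sets \<open>A\<close> and \<open>B\<close> the set \<open>A\<inverse>B\<close> is
  analytic but possibly not Borel, so its size is taken with the outer measure (on analytic sets
  this is the completed Haar measure, and on Borel sets it is the Haar measure).
\<close>

definition strong_folner ::
  "'g::{topological_group_add, second_countable_topology, t2_space} measure \<Rightarrow> (nat \<Rightarrow> 'g set) \<Rightarrow> bool"
  where
  "strong_folner \<mu> \<Phi> \<longleftrightarrow>
     (\<forall>n. \<Phi> n \<in> sets \<mu> \<and> 0 < emeasure \<mu> (\<Phi> n) \<and> emeasure \<mu> (\<Phi> n) < \<infinity>) \<and>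
     (\<forall>K. compact K \<longrightarrow>
        (\<lambda>n. outer_measure_of \<mu> (group_boundary K (\<Phi> n)) / emeasure \<mu> (\<Phi> n)) \<longlonglongrightarrow> 0)"

definition tempered ::
  "'g::{topological_group_add, second_countable_topology, t2_space} measure \<Rightarrow> (nat \<Rightarrow> 'g set) \<Rightarrow> bool"
  where
  "tempered \<mu> \<Phi> \<longleftrightarrow>
     (\<exists>C::real. \<forall>j. outer_measure_of \<mu> (\<Union>i<j. inv_prod (\<Phi> i) (\<Phi> j))
                     < ennreal C * emeasure \<mu> (\<Phi> j))"

definition average :: "'g measure \<Rightarrow> 'g set \<Rightarrow> ('g \<Rightarrow> 'b::{banach, second_countable_topology}) \<Rightarrow> 'b"
  where
  "average \<mu> A h = (1 / measure \<mu> A) *\<^sub>R (LINT g:A|\<mu>. h g)"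

definition lower_density :: "'g measure \<Rightarrow> (nat \<Rightarrow> 'g set) \<Rightarrow> 'g set \<Rightarrow> ereal" where
  "lower_density \<mu> \<Phi> S = liminf (\<lambda>N. ereal (measure \<mu> (S \<inter> \<Phi> N) / measure \<mu> (\<Phi> N)))"

locale mp_system = prob_space M
  for M :: "'x measure" +
  fixes act :: "'g::{topological_group_add, second_countable_topology, t2_space} \<Rightarrow> 'x \<Rightarrow> 'x"
  assumes act_measurable: "(\<lambda>(g, x). act g x) \<in> borel \<Otimes>\<^sub>M M \<rightarrow>\<^sub>M M"
    and act_zero: "x \<in> space M \<Longrightarrow> act 0 x = x"
    and act_plus: "x \<in> space M \<Longrightarrow> act (g + h) x = act g (act h x)"
    and act_preserving: "distr M M (act g) = M"

locale ergodic_mp_system = mp_system M act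
  for M :: "'x measure"
    and act :: "'g::{topological_group_add, second_countable_topology, t2_space} \<Rightarrow> 'x \<Rightarrow> 'x" +
  assumes ergodic: "A \<in> sets M \<Longrightarrow> (\<And>g. act g -` A \<inter> space M = A) \<Longrightarrow> prob A = 0 \<or> prob A = 1"

end

theory Submission
  imports Defs
begin

text \<open>
  Write \<open>A\<^sub>n F(x)\<close> for the average of \<open>c(g) F(gx)\<close> over \<open>g \<in> \<Phi>\<^sub>n\<close>. After passing to real and
  imaginary parts and replacing \<open>F\<close> by \<open>- F\<close>, it is enough to refute that \<open>A\<^sub>n F > \<epsilon>\<close> infinitely
  often on a set \<open>E\<close> of positive measure. This is done by decreasing the energy \<open>\<integral>F\<^sup>2\<close>:
  there are functions \<open>V\<close> bounded by \<open>1\<close> such that \<open>\<integral>F V\<close> is at least a constant \<open>\<rho>\<close> which depends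
  only on \<open>\<epsilon>\<close>, \<open>E\<close> and the temperedness constant (lemma \<open>correlating_tile\<close>), although
  \<open>A\<^sub>n V\<close> is as small as desired, uniformly on the whole space, for all large \<open>n\<close> (lemma
  \<open>tile_asymptotically_orthogonal\<close>). Passing from \<open>F\<close> to \<open>F - \<rho>V\<close> lowers the energy by at least
  \<open>\<rho>\<^sup>2\<close> and hardly changes the upper limit of the averages. After boundedly many steps the energy
  would be negative (lemma \<open>no_positive_upper_average\<close>).

  The function \<open>V\<close> is a superposition of pieces of \<open>c\<close> copied along orbits:
  \<open>V(x)\<close> is the sum over \<open>L \<le> n \<le> R\<close> of the averages of \<open>c(g) w\<^sub>n(g\<inverse>x)\<close> over \<open>g \<in> \<Phi>\<^sub>n\<close>, where the
  weight \<open>w\<^sub>n \<ge> 0\<close> lives on a set where \<open>A\<^sub>n F > \<epsilon>\<close>. By duality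
  \<open>\<integral>F V = \<Sum>\<^sub>n \<integral>w\<^sub>n A\<^sub>n F \<ge> \<epsilon> \<Sum>\<^sub>n \<integral>w\<^sub>n\<close>. So the weights should have a large total mass while \<open>\<bar>V\<bar> \<le> 1\<close>.
  The latter holds if the load, the sum over \<open>n\<close> of the averages of \<open>w\<^sub>n(g\<inverse>x)\<close>, is at most \<open>1\<close> at every
  \<open>x\<close>. That both can be achieved is a fractional and deterministic form of Lindenstrauss' covering
  lemma for tempered sequences (lemma \<open>fractional_covering\<close>).

  To see that \<open>A\<^sub>n V\<close> is small, expand it as a double average of \<open>c(g) c(k) w\<^sub>i(k\<inverse>gx)\<close> over
  \<open>g \<in> \<Phi>\<^sub>n\<close> and \<open>k \<in> \<Phi>\<^sub>i\<close> and substitute \<open>g = ka\<close>. As \<open>n \<rightarrow> \<infinity>\<close>, the Folner property lets \<open>a\<close> range over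
  \<open>\<Phi>\<^sub>n\<close> at a negligible cost. The inner average over \<open>k\<close> then becomes the correlation of \<open>c\<close> with
  its translate by \<open>a\<close> along \<open>\<Phi>\<^sub>i\<close>. By hypothesis it is small unless \<open>a\<close> belongs to a set that has small
  density in \<open>\<Phi>\<^sub>n\<close>.
\<close>

section \<open>Haar measure and measurability on groups\<close>

lemma borel_measurable_group_uminus [measurable (raw)]:
  fixes f :: "'a \<Rightarrow> 'g::{topological_group_add, second_countable_topology}"
  assumes "f \<in> borel_measurable N"
  shows "(\<lambda>x. - f x) \<in> borel_measurable N"
  by (rule borel_measurable_continuous_on[OF _ assms]) (intro continuous_intros)

lemma (in pair_sigma_finite) integrable_tensor_times_bounded:
  fixes h1 :: "'a \<Rightarrow> real" and h2 :: "'b \<Rightarrow> real"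
  assumes h1: "integrable M1 h1" and h2: "integrable M2 h2"
    and \<phi>[measurable]: "case_prod \<phi> \<in> borel_measurable (M1 \<Otimes>\<^sub>M M2)"
    and B: "\<And>x y. x \<in> space M1 \<Longrightarrow> y \<in> space M2 \<Longrightarrow> \<bar>\<phi> x y\<bar> \<le> B"
  shows "integrable (M1 \<Otimes>\<^sub>M M2) (\<lambda>(x, y). h1 x * h2 y * \<phi> x y)"
proof -
  note [measurable] = borel_measurable_integrable[OF h1] borel_measurable_integrable[OF h2]
  have *: "integrable (M1 \<Otimes>\<^sub>M M2) (\<lambda>(x, y). h1 x * h2 y)"
  proof (rule Fubini_integrable)
    show "integrable M1 (\<lambda>x. \<integral>y. norm (case (x, y) of (x, y) \<Rightarrow> h1 x * h2 y) \<partial>M2)"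
      using h1 by (simp add: abs_mult)
    show "AE x in M1. integrable M2 (\<lambda>y. case (x, y) of (x, y) \<Rightarrow> h1 x * h2 y)"
      using h2 by simp
  qed simp
  have "integrable (M1 \<Otimes>\<^sub>M M2) (\<lambda>z. B * (case z of (x, y) \<Rightarrow> h1 x * h2 y))"
    using * by simp
  then show ?thesis
  proof (rule Bochner_Integration.integrable_bound)
    show "AE z in M1 \<Otimes>\<^sub>M M2. norm (case z of (x, y) \<Rightarrow> h1 x * h2 y * \<phi> x y)
            \<le> norm (B * (case z of (x, y) \<Rightarrow> h1 x * h2 y))"
    proof (rule AE_I2)
      fix z assume "z \<in> space (M1 \<Otimes>\<^sub>M M2)"
      then obtain x y where z: "z = (x, y)" "x \<in> space M1" "y \<in> space M2"
        by (auto simp: space_pair_measure)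
      have "\<bar>\<phi> x y\<bar> \<le> \<bar>B\<bar>" using B[OF z(2,3)] by linarith
      then have "\<bar>h1 x * h2 y\<bar> * \<bar>\<phi> x y\<bar> \<le> \<bar>h1 x * h2 y\<bar> * \<bar>B\<bar>"
        by (intro mult_left_mono) auto
      then show "norm (case z of (x, y) \<Rightarrow> h1 x * h2 y * \<phi> x y)
            \<le> norm (B * (case z of (x, y) \<Rightarrow> h1 x * h2 y))"
        by (simp add: z abs_mult mult_ac)
    qed
  qed simp
qed

text \<open>
  Countably many compact sets cover the group, by local compactness and the Lindeloef property.
\<close>

lemma left_haar_sigma_finite:
  fixes \<mu> :: "'g::{topological_group_add, second_countable_topology, t2_space} measure"
  assumes lc: "locally_compact_space (euclidean :: 'g topology)" and haar: "left_haar_measure \<mu>"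
  shows "sigma_finite_measure \<mu>"
proof -
  obtain U K :: "'g \<Rightarrow> 'g set"
    where UK: "\<And>x. open (U x)" "\<And>x. compact (K x)" "\<And>x. x \<in> U x" "\<And>x. U x \<subseteq> K x"
    using lc unfolding locally_compact_space_def by (simp add: open_openin[symmetric]) metis
  obtain \<F> where \<F>: "\<F> \<subseteq> range U" "countable \<F>" "\<Union>\<F> = \<Union>(range U)"
    using Lindelof[of "range U"] UK(1) by blast
  obtain I where I: "countable I" "\<F> = U ` I"
    using \<F>(1,2) countable_subset_image[of \<F> U UNIV] by auto
  show ?thesis
  proof
    have "\<Union>(K ` I) = UNIV" using \<F>(3) I UK(3,4) by blast
    moreover have "K x \<in> sets \<mu>" for x
      using haar UK(2)[of x] by (auto simp: left_haar_measure_def intro!: borel_closed compact_imp_closed)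
    moreover have "emeasure \<mu> (K x) \<noteq> \<infinity>" for x
      using haar UK(2)[of x] by (auto simp: left_haar_measure_def less_top)
    moreover have "space \<mu> = UNIV"
      using haar sets_eq_imp_space_eq[of \<mu> borel] by (simp add: left_haar_measure_def)
    ultimately show "\<exists>A. countable A \<and> A \<subseteq> sets \<mu> \<and> \<Union> A = space \<mu> \<and> (\<forall>a\<in>A. emeasure \<mu> a \<noteq> \<infinity>)"
      using I(1) by (intro exI[of _ "K ` I"]) auto
  qed
qed

lemma left_haar_distr:
  fixes \<mu> :: "'g::{topological_group_add, second_countable_topology, t2_space} measure"
  assumes "left_haar_measure \<mu>"
  shows "distr \<mu> \<mu> ((+) g) = \<mu>"
proof (rule measure_eqI)
  have s[measurable_cong]: "sets \<mu> = sets borel" using assms by (simp add: left_haar_measure_def)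
  then have sp: "space \<mu> = UNIV" using sets_eq_imp_space_eq[of \<mu> borel] by simp
  fix A assume "A \<in> sets (distr \<mu> \<mu> ((+) g))"
  then have A: "A \<in> sets borel" by (simp add: s)
  have "(+) g -` A = (+) (- g) ` A"
    by (auto simp: image_iff add.assoc[symmetric] intro!: bexI[where x = "g + _"])
  then show "emeasure (distr \<mu> \<mu> ((+) g)) A = emeasure \<mu> A"
    using assms A by (subst emeasure_distr) (auto simp: s sp left_haar_measure_def)
qed simp

section \<open>Averages along orbits\<close>

locale haar_action = mp_system M act
  for M :: "'x measure"
    and act :: "'g::{topological_group_add, second_countable_topology, t2_space} \<Rightarrow> 'x \<Rightarrow> 'x" +
  fixes \<mu> :: "'g measure"
  assumes haar: "left_haar_measure \<mu>"
    and sigma_finite: "sigma_finite_measure \<mu>"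
begin

lemma sets_haar [measurable_cong]: "sets \<mu> = sets borel"
  using haar by (simp add: left_haar_measure_def)

lemma space_haar [simp]: "space \<mu> = UNIV"
  using sets_eq_imp_space_eq[OF sets_haar] by simp

sublocale G: sigma_finite_measure \<mu> by (rule sigma_finite)
sublocale GX: pair_sigma_finite \<mu> M ..
sublocale GG: pair_sigma_finite \<mu> \<mu> ..

lemma measurable_act [measurable (raw)]:
  assumes "g \<in> borel_measurable N" "x \<in> N \<rightarrow>\<^sub>M M"
  shows "(\<lambda>z. act (g z) (x z)) \<in> N \<rightarrow>\<^sub>M M"
  using measurable_compose[OF measurable_Pair[OF assms] act_measurable] by simp

lemma act_space [simp]: "x \<in> space M \<Longrightarrow> act g x \<in> space M"
  using measurable_space[OF act_measurable, of "(g, x)"] by (simp add: space_pair_measure)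

lemma act_uminus [simp]: "x \<in> space M \<Longrightarrow> act (- g) (act g x) = x"
  by (simp add: act_plus[symmetric] act_zero)

lemma integral_act:
  fixes F :: "'x \<Rightarrow> real"
  assumes [measurable]: "F \<in> borel_measurable M"
  shows "(\<integral>x. F (act g x) \<partial>M) = (\<integral>x. F x \<partial>M)"
proof -
  have "(\<integral>x. F x \<partial>distr M M (act g)) = (\<integral>x. F (act g x) \<partial>M)"
    by (rule integral_distr) auto
  then show ?thesis by (simp add: act_preserving)
qed

lemma integral_translate:
  fixes h :: "'g \<Rightarrow> real"
  assumes [measurable]: "h \<in> borel_measurable \<mu>"
  shows "(\<integral>a. h (g + a) \<partial>\<mu>) = (\<integral>a. h a \<partial>\<mu>)"
proof -
  have "(\<integral>a. h a \<partial>distr \<mu> \<mu> ((+) g)) = (\<integral>a. h (g + a) \<partial>\<mu>)"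
    by (rule integral_distr) auto
  then show ?thesis by (simp add: left_haar_distr[OF haar])
qed

lemma integrable_translate:
  fixes h :: "'g \<Rightarrow> real"
  assumes "integrable \<mu> h"
  shows "integrable \<mu> (\<lambda>a. h (g + a))"
proof -
  note [measurable] = borel_measurable_integrable[OF assms]
  have "integrable (distr \<mu> \<mu> ((+) g)) h" using assms by (simp add: left_haar_distr[OF haar])
  then show ?thesis by (subst (asm) integrable_distr_eq) auto
qed

definition bdd :: "real \<Rightarrow> ('x \<Rightarrow> real) \<Rightarrow> bool" where
  "bdd B F \<longleftrightarrow> F \<in> borel_measurable M \<and> (\<forall>x\<in>space M. \<bar>F x\<bar> \<le> B)"

lemma bddD: "bdd B F \<Longrightarrow> x \<in> space M \<Longrightarrow> \<bar>F x\<bar> \<le> B"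
  and bdd_measurable [measurable_dest]: "bdd B F \<Longrightarrow> F \<in> borel_measurable M"
  by (auto simp: bdd_def)

lemma bdd_nonneg: "bdd B F \<Longrightarrow> 0 \<le> B"
  using not_empty by (fastforce simp: bdd_def)

lemma bdd_integrable: "bdd B F \<Longrightarrow> integrable M F"
  by (rule integrable_const_bound[where B = B]) (auto simp: bdd_def)

lemma bdd_mult: "bdd B F \<Longrightarrow> bdd B' F' \<Longrightarrow> bdd (B * B') (\<lambda>x. F x * F' x)"
  by (auto simp: bdd_def abs_mult intro!: mult_mono order_trans[OF abs_ge_zero])

lemma bdd_add: "bdd B F \<Longrightarrow> bdd B' F' \<Longrightarrow> bdd (B + B') (\<lambda>x. F x + F' x)"
  by (auto simp: bdd_def intro!: order_trans[OF abs_triangle_ineq] add_mono)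

lemma bdd_scale: "bdd B F \<Longrightarrow> bdd (\<bar>r\<bar> * B) (\<lambda>x. r * F x)"
  by (auto simp: bdd_def abs_mult intro!: mult_left_mono)

lemma bdd_sum: "(\<And>i. i \<in> I \<Longrightarrow> bdd (B i) (F i)) \<Longrightarrow> bdd (\<Sum>i\<in>I. B i) (\<lambda>x. \<Sum>i\<in>I. F i x)"
  by (auto simp: bdd_def intro!: order_trans[OF sum_abs] sum_mono borel_measurable_sum)

text \<open>
  For a kernel \<open>h\<close> on the group, \<open>pull h\<close> averages a function over the forward orbit \<open>gx\<close>, and
  \<open>push h\<close>, its formal adjoint on \<open>L\<^sup>2(M)\<close>, spreads the mass sitting at \<open>y\<close> over the points \<open>gy\<close>.
\<close>

definition pull :: "('g \<Rightarrow> real) \<Rightarrow> ('x \<Rightarrow> real) \<Rightarrow> 'x \<Rightarrow> real" where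
  "pull h F x = (\<integral>g. h g * F (act g x) \<partial>\<mu>)"

definition push :: "('g \<Rightarrow> real) \<Rightarrow> ('x \<Rightarrow> real) \<Rightarrow> 'x \<Rightarrow> real" where
  "push h w x = (\<integral>g. h g * w (act (- g) x) \<partial>\<mu>)"

lemma integrable_times_bounded:
  fixes h k :: "'g \<Rightarrow> real"
  assumes "integrable \<mu> h" "k \<in> borel_measurable \<mu>" "\<And>g. \<bar>k g\<bar> \<le> B"
  shows "integrable \<mu> (\<lambda>g. h g * k g)"
proof (rule Bochner_Integration.integrable_bound)
  show "integrable \<mu> (\<lambda>g. B * h g)" using assms(1) by simp
  show "(\<lambda>g. h g * k g) \<in> borel_measurable \<mu>" using assms(1,2) by auto
  have "\<bar>h g\<bar> * \<bar>k g\<bar> \<le> \<bar>B\<bar> * \<bar>h g\<bar>" for g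
    using mult_left_mono[of "\<bar>k g\<bar>" "\<bar>B\<bar>" "\<bar>h g\<bar>"] assms(3)[of g] by (simp add: mult.commute)
  then show "AE g in \<mu>. norm (h g * k g) \<le> norm (B * h g)" by (simp add: abs_mult)
qed

lemma integrable_pull:
  assumes "integrable \<mu> h" and F: "bdd B F" and x: "x \<in> space M"
  shows "integrable \<mu> (\<lambda>g. h g * F (act g x))"
proof (rule integrable_times_bounded[OF assms(1)])
  note [measurable] = bdd_measurable[OF F]
  show "(\<lambda>g. F (act g x)) \<in> borel_measurable \<mu>" using x by measurable
qed (use F x in \<open>auto intro: bddD\<close>)

lemma integrable_push:
  assumes "integrable \<mu> h" and F: "bdd B F" and x: "x \<in> space M"
  shows "integrable \<mu> (\<lambda>g. h g * F (act (- g) x))"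
proof (rule integrable_times_bounded[OF assms(1)])
  note [measurable] = bdd_measurable[OF F]
  show "(\<lambda>g. F (act (- g) x)) \<in> borel_measurable \<mu>" using x by measurable
qed (use F x in \<open>auto intro: bddD\<close>)

lemma bdd_pull:
  assumes h: "integrable \<mu> h" and w: "bdd B w"
  shows "bdd ((\<integral>g. \<bar>h g\<bar> \<partial>\<mu>) * B) (pull h w)"
  unfolding bdd_def
proof (intro conjI ballI)
  note [measurable] = borel_measurable_integrable[OF h] bdd_measurable[OF w]
  show "pull h w \<in> borel_measurable M" unfolding pull_def by measurable
  fix x assume x: "x \<in> space M"
  have "\<bar>pull h w x\<bar> \<le> (\<integral>g. \<bar>h g * w (act g x)\<bar> \<partial>\<mu>)"
    unfolding pull_def using integral_norm_bound[of \<mu> "\<lambda>g. h g * w (act g x)"] by simp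
  also have "\<dots> \<le> (\<integral>g. \<bar>h g\<bar> * B \<partial>\<mu>)"
    using integrable_abs[OF integrable_pull[OF h w x]] h bddD[OF w act_space[OF x]]
    by (intro integral_mono) (auto simp: abs_mult intro: mult_left_mono)
  finally show "\<bar>pull h w x\<bar> \<le> (\<integral>g. \<bar>h g\<bar> \<partial>\<mu>) * B" by simp
qed

lemma bdd_push:
  assumes h: "integrable \<mu> h" and w: "bdd B w"
  shows "bdd ((\<integral>g. \<bar>h g\<bar> \<partial>\<mu>) * B) (push h w)"
  unfolding bdd_def
proof (intro conjI ballI)
  note [measurable] = borel_measurable_integrable[OF h] bdd_measurable[OF w]
  show "push h w \<in> borel_measurable M" unfolding push_def by measurable
  fix x assume x: "x \<in> space M"
  have "\<bar>push h w x\<bar> \<le> (\<integral>g. \<bar>h g * w (act (- g) x)\<bar> \<partial>\<mu>)"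
    unfolding push_def using integral_norm_bound[of \<mu> "\<lambda>g. h g * w (act (- g) x)"] by simp
  also have "\<dots> \<le> (\<integral>g. \<bar>h g\<bar> * B \<partial>\<mu>)"
    using integrable_abs[OF integrable_push[OF h w x]] h bddD[OF w act_space[OF x]]
    by (intro integral_mono) (auto simp: abs_mult intro: mult_left_mono)
  finally show "\<bar>push h w x\<bar> \<le> (\<integral>g. \<bar>h g\<bar> \<partial>\<mu>) * B" by simp
qed

text \<open>
  Each \<open>act g\<close> preserves \<open>M\<close>, so the substitution of \<open>gx\<close> for \<open>x\<close> proves the duality for every fixed \<open>g\<close>;
  then integrate over \<open>g\<close>. No modular function enters, although the measure on the group is only
  left invariant.
\<close>

lemma push_dual_pull:
  assumes h: "integrable \<mu> h" and F: "bdd B F" and w: "bdd B' w"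
  shows "(\<integral>x. F x * push h w x \<partial>M) = (\<integral>x. w x * pull h F x \<partial>M)"
proof -
  note [measurable] = borel_measurable_integrable[OF h] bdd_measurable[OF F] bdd_measurable[OF w]
  note bnd = mult_mono[OF bddD[OF F] bddD[OF w] bdd_nonneg[OF F] abs_ge_zero]
  have int1: "integrable (\<mu> \<Otimes>\<^sub>M M) (\<lambda>(g, x). h g * 1 * (F x * w (act (- g) x)))"
    by (rule GX.integrable_tensor_times_bounded[where B = "B * B'"])
       (use h bnd in \<open>auto simp: abs_mult\<close>)
  have int2: "integrable (\<mu> \<Otimes>\<^sub>M M) (\<lambda>(g, x). h g * 1 * (F (act g x) * w x))"
    by (rule GX.integrable_tensor_times_bounded[where B = "B * B'"])
       (use h bnd in \<open>auto simp: abs_mult\<close>)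
  have "(\<integral>x. F x * push h w x \<partial>M) = (\<integral>x. (\<integral>g. h g * 1 * (F x * w (act (- g) x)) \<partial>\<mu>) \<partial>M)"
    by (simp add: push_def mult_ac flip: integral_mult_right_zero)
  also have "\<dots> = (\<integral>g. (\<integral>x. h g * 1 * (F x * w (act (- g) x)) \<partial>M) \<partial>\<mu>)"
    by (rule GX.Fubini_integral[OF int1])
  also have "\<dots> = (\<integral>g. (\<integral>x. h g * 1 * (F (act g x) * w x) \<partial>M) \<partial>\<mu>)"
  proof (rule Bochner_Integration.integral_cong[OF refl])
    fix g
    have "(\<integral>x. F x * w (act (- g) x) \<partial>M) = (\<integral>x. F (act g x) * w (act (- g) (act g x)) \<partial>M)"
      by (rule integral_act[symmetric]) simp
    also have "\<dots> = (\<integral>x. F (act g x) * w x \<partial>M)"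
      by (rule Bochner_Integration.integral_cong) auto
    finally show "(\<integral>x. h g * 1 * (F x * w (act (- g) x)) \<partial>M)
        = (\<integral>x. h g * 1 * (F (act g x) * w x) \<partial>M)" by simp
  qed
  also have "\<dots> = (\<integral>x. (\<integral>g. h g * 1 * (F (act g x) * w x) \<partial>\<mu>) \<partial>M)"
    by (rule GX.Fubini_integral[OF int2, symmetric])
  also have "\<dots> = (\<integral>x. w x * pull h F x \<partial>M)"
    by (simp add: pull_def mult_ac flip: integral_mult_right_zero)
  finally show ?thesis .
qed

end

section \<open>Fractional covering by tempered sequences\<close>

text \<open>
  The kernels abstract from a tempered sequence \<open>\<Phi>\<close>: \<open>p n\<close> is the density of the uniform distribution on
  \<open>\<Phi>\<^sub>n\<close>, and \<open>q j\<close> is the indicator of a set containing \<open>\<Phi>\<^sub>i\<inverse>\<Phi>\<^sub>j\<close> for all \<open>i < j\<close>, divided by the measure of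
  \<open>\<Phi>\<^sub>j\<close>. If \<open>g \<in> \<Phi>\<^sub>i\<close> and \<open>k \<in> \<Phi>\<^sub>j\<close>, then \<open>g\<inverse>k \<in> \<Phi>\<^sub>i\<inverse>\<Phi>\<^sub>j\<close>; this is the last assumption.
\<close>

locale tempered_kernels = haar_action M act \<mu>
  for M :: "'x measure"
    and act :: "'g::{topological_group_add, second_countable_topology, t2_space} \<Rightarrow> 'x \<Rightarrow> 'x"
    and \<mu> :: "'g measure" +
  fixes p q :: "nat \<Rightarrow> 'g \<Rightarrow> real" and C :: real
  assumes p_integrable: "integrable \<mu> (p n)" and p_nonneg: "0 \<le> p n g"
    and p_mass: "(\<integral>g. p n g \<partial>\<mu>) = 1"
    and q_integrable: "integrable \<mu> (q n)" and q_nonneg: "0 \<le> q n g"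
    and q_mass: "(\<integral>g. q n g \<partial>\<mu>) \<le> C"
    and p_le_q: "i < j \<Longrightarrow> p i g \<noteq> 0 \<Longrightarrow> p j k \<le> q j (- g + k)"
begin

lemma C_nonneg: "0 \<le> C"
  using q_mass[of 0] Bochner_Integration.integral_nonneg[of \<mu> "q 0"] q_nonneg by (smt (verit))

text \<open>
  A greedy choice that starts with the largest index \<open>R\<close>. Mass put at a point \<open>y\<close> with index \<open>j\<close> will load
  the points of \<open>\<Phi>\<^sub>jy\<close>, so it must discourage every \<open>x\<close> for which \<open>\<Phi>\<^sub>ix\<close> meets \<open>\<Phi>\<^sub>jy\<close> for some \<open>i < j\<close>, that
  is, every \<open>x \<in> \<Phi>\<^sub>i\<inverse>\<Phi>\<^sub>jy\<close>. Spreading with the kernel \<open>q j\<close> records this, and the weight with index \<open>n\<close> uses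
  only the capacity that the larger indices have left over.
\<close>

function cover_weight :: "(nat \<Rightarrow> 'x set) \<Rightarrow> nat \<Rightarrow> nat \<Rightarrow> 'x \<Rightarrow> real" where
  "cover_weight B R n =
     (\<lambda>x. indicator (B n) x * max 0 (1 - (\<Sum>j\<in>{n<..R}. push (q j) (cover_weight B R j) x)))"
  by auto
termination by (relation "Wellfounded.measure (\<lambda>(B, R, n). R - n)") auto

declare cover_weight.simps [simp del]

lemma push_nonneg:
  assumes "\<And>g. 0 \<le> h g" "\<And>x. x \<in> space M \<Longrightarrow> 0 \<le> w x" "x \<in> space M"
  shows "0 \<le> push h w x"
  unfolding push_def using assms by (intro Bochner_Integration.integral_nonneg) auto

context
  fixes B :: "nat \<Rightarrow> 'x set" and R :: nat
  assumes B [measurable]: "\<And>n. B n \<in> sets M"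
begin

abbreviation "\<omega> \<equiv> cover_weight B R"

lemma cover_weight_nonneg: "0 \<le> \<omega> n x"
  by (subst cover_weight.simps) auto

lemma bdd_cover_weight: "bdd 1 (\<omega> n)"
proof (induction "R - n" arbitrary: n rule: less_induct)
  case less
  have IH: "bdd 1 (\<omega> j)" if "j \<in> {n<..R}" for j using that by (intro less) auto
  note meas = bdd_measurable[OF bdd_push[OF q_integrable IH]]
  have "\<omega> n \<in> borel_measurable M"
    by (subst cover_weight.simps) (use meas in measurable)
  moreover have "\<omega> n x \<le> 1" if "x \<in> space M" for x
  proof -
    have "0 \<le> (\<Sum>j\<in>{n<..R}. push (q j) (\<omega> j) x)"
      using that by (intro sum_nonneg push_nonneg) (auto simp: q_nonneg cover_weight_nonneg)
    then show ?thesis by (subst cover_weight.simps) (auto simp: indicator_def)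
  qed
  ultimately show ?case by (auto simp: bdd_def cover_weight_nonneg)
qed

lemma push_q_nonneg: "x \<in> space M \<Longrightarrow> 0 \<le> push (q j) (\<omega> j) x"
  by (intro push_nonneg) (auto simp: q_nonneg cover_weight_nonneg)

lemma cover_weight_le_indicator:
  assumes "x \<in> space M" shows "\<omega> n x \<le> indicator (B n) x"
proof (cases "x \<in> B n")
  case True then show ?thesis using bddD[OF bdd_cover_weight[of n] assms] by simp
next
  case False then show ?thesis by (subst cover_weight.simps) simp
qed

text \<open>
  The discouragement recorded at \<open>g\<inverse>x\<close>, for any \<open>g \<in> \<Phi>\<^sub>i\<close>, is at least the load that index \<open>j\<close> puts on \<open>x\<close>.
  This is what \<open>p_le_q\<close> gives after a left translation of the integration variable.
\<close>

lemma push_p_le_push_q: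
  assumes "i < j" "p i g \<noteq> 0" and x: "x \<in> space M"
  shows "push (p j) (\<omega> j) x \<le> push (q j) (\<omega> j) (act (- g) x)"
proof -
  note [measurable] = borel_measurable_integrable[OF q_integrable] bdd_measurable[OF bdd_cover_weight]
  let ?H = "\<lambda>k. q j (- g + k) * \<omega> j (act (- k) x)"
  have "push (p j) (\<omega> j) x \<le> (\<integral>k. ?H k \<partial>\<mu>)"
    unfolding push_def
    using integrable_push[OF p_integrable bdd_cover_weight x]
      integrable_push[OF integrable_translate[OF q_integrable] bdd_cover_weight x]
      p_le_q[OF assms(1,2)]
    by (intro integral_mono) (auto intro!: mult_right_mono cover_weight_nonneg)
  also have "\<dots> = (\<integral>k. ?H (g + k) \<partial>\<mu>)"
    using x by (intro integral_translate[symmetric]) measurable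
  also have "\<dots> = push (q j) (\<omega> j) (act (- g) x)"
    unfolding push_def using x
    by (intro Bochner_Integration.integral_cong)
       (auto simp: minus_add add.assoc[symmetric] act_plus[symmetric])
  finally show ?thesis .
qed

text \<open>
  The indices are added in decreasing order. If \<open>u\<close> is the load at \<open>x\<close> so far, then all points \<open>g\<inverse>x\<close> from which
  the index \<open>n\<close> reaches \<open>x\<close> carry weight at most \<open>1 - u\<close>, and so does their average.
\<close>

lemma cover_load_le_1:
  assumes x: "x \<in> space M"
  shows "(\<Sum>j\<in>{n..R}. push (p j) (\<omega> j) x) \<le> 1"
proof (cases "n \<le> Suc R")
  case True
  then show ?thesis
  proof (induction rule: inc_induct)
    case (step n)
    let ?u = "\<Sum>j\<in>{Suc n..R}. push (p j) (\<omega> j) x"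
    have "push (p n) (\<omega> n) x \<le> (\<integral>g. p n g * (1 - ?u) \<partial>\<mu>)"
      unfolding push_def
    proof (rule integral_mono)
      fix g
      show "p n g * \<omega> n (act (- g) x) \<le> p n g * (1 - (\<Sum>j\<in>{Suc n..R}. \<integral>g. p j g * \<omega> j (act (- g) x) \<partial>\<mu>))"
      proof (cases "p n g = 0")
        case False
        have "?u \<le> (\<Sum>j\<in>{n<..R}. push (q j) (\<omega> j) (act (- g) x))"
          unfolding atLeastSucAtMost_greaterThanAtMost
          by (intro sum_mono push_p_le_push_q[OF _ False x]) auto
        then have "\<omega> n (act (- g) x) \<le> 1 - ?u"
          using step.IH by (subst cover_weight.simps) (auto simp: indicator_def)
        then show ?thesis unfolding push_def by (intro mult_left_mono p_nonneg)
      qed simp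
    qed (use integrable_push[OF p_integrable bdd_cover_weight x] p_integrable in auto)
    also have "\<dots> = 1 - ?u" by (simp add: p_mass)
    finally show ?case using step.hyps by (simp add: sum.atLeast_Suc_atMost)
  qed simp
qed simp

lemma integral_push_q: "(\<integral>x. push (q j) (\<omega> j) x \<partial>M) \<le> C * (\<integral>x. \<omega> j x \<partial>M)"
proof -
  have "bdd 1 (\<lambda>x. 1)" by (simp add: bdd_def)
  from push_dual_pull[OF q_integrable this bdd_cover_weight]
  have "(\<integral>x. push (q j) (\<omega> j) x \<partial>M) = (\<integral>g. q j g \<partial>\<mu>) * (\<integral>x. \<omega> j x \<partial>M)"
    by (simp add: pull_def)
  also have "\<dots> \<le> C * (\<integral>x. \<omega> j x \<partial>M)"
    by (intro mult_right_mono q_mass Bochner_Integration.integral_nonneg) (auto simp: cover_weight_nonneg)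
  finally show ?thesis .
qed

text \<open>
  A point of \<open>B n\<close> loses at most what the larger indices record there, and the recorded amount
  has total mass at most \<open>C\<close> times the mass of the weights.
\<close>

lemma cover_weight_total:
  assumes disj: "disjoint_family_on B {L..R}"
  shows "prob (\<Union>n\<in>{L..R}. B n) \<le> (1 + C) * (\<Sum>n\<in>{L..R}. \<integral>x. \<omega> n x \<partial>M)"
proof -
  let ?b = "\<lambda>n x. indicator (B n) x :: real"
  let ?k = "\<lambda>x. \<Sum>j\<in>{L..R}. push (q j) (\<omega> j) x"
  have int: "integrable M (\<omega> n)" "integrable M (push (q n) (\<omega> n))" for n
    using bdd_cover_weight bdd_push[OF q_integrable bdd_cover_weight] by (auto intro: bdd_integrable)
  have ind: "indicator (\<Union>n\<in>{L..R}. B n) x = (\<Sum>n\<in>{L..R}. ?b n x)" for x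
    using disj by (intro indicator_UN_disjoint) auto
  have "indicator (\<Union>n\<in>{L..R}. B n) x \<le> (\<Sum>n\<in>{L..R}. \<omega> n x) + ?k x" if x: "x \<in> space M" for x
  proof -
    have "?b n x \<le> \<omega> n x + ?b n x * ?k x" if "n \<in> {L..R}" for n
    proof -
      have "(\<Sum>j\<in>{n<..R}. push (q j) (\<omega> j) x) \<le> ?k x"
        using that x by (intro sum_mono2) (auto simp: push_q_nonneg)
      moreover have "\<omega> n x = ?b n x * max 0 (1 - (\<Sum>j\<in>{n<..R}. push (q j) (\<omega> j) x))"
        by (subst cover_weight.simps) simp
      ultimately show ?thesis by (auto simp: indicator_def)
    qed
    then have "(\<Sum>n\<in>{L..R}. ?b n x) \<le> (\<Sum>n\<in>{L..R}. \<omega> n x) + (\<Sum>n\<in>{L..R}. ?b n x) * ?k x"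
      by (subst sum_distrib_right, subst sum.distrib[symmetric]) (rule sum_mono)
    also have "(\<Sum>n\<in>{L..R}. ?b n x) * ?k x \<le> 1 * ?k x"
      unfolding ind[symmetric] using x
      by (intro mult_right_mono sum_nonneg push_q_nonneg) (auto simp: indicator_def)
    finally show ?thesis by (simp add: ind)
  qed
  then have "(\<integral>x. indicator (\<Union>n\<in>{L..R}. B n) x \<partial>M) \<le> (\<integral>x. (\<Sum>n\<in>{L..R}. \<omega> n x) + ?k x \<partial>M)"
    using int by (intro integral_mono) (auto simp: less_top[symmetric])
  also have "\<dots> = (\<Sum>n\<in>{L..R}. \<integral>x. \<omega> n x \<partial>M) + (\<Sum>n\<in>{L..R}. \<integral>x. push (q n) (\<omega> n) x \<partial>M)"
    using int by simp
  also have "\<dots> \<le> (\<Sum>n\<in>{L..R}. \<integral>x. \<omega> n x \<partial>M) + (\<Sum>n\<in>{L..R}. C * (\<integral>x. \<omega> n x \<partial>M))"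
    by (intro add_left_mono sum_mono integral_push_q)
  also have "\<dots> = (1 + C) * (\<Sum>n\<in>{L..R}. \<integral>x. \<omega> n x \<partial>M)"
    by (simp add: distrib_right sum_distrib_left sum.distrib)
  finally show ?thesis by simp
qed

end

text \<open>
  Lindenstrauss' covering lemma selects the centres \<open>y\<close> of the sets \<open>\<Phi>\<^sub>ny\<close> at random. Since only linear
  expressions in the selection are needed, the indicator of the selected centres can be
  replaced by a weight with values between \<open>0\<close> and \<open>1\<close>, and the construction takes place in \<open>M\<close> itself.
\<close>

lemma fractional_covering:
  assumes "\<And>n. B n \<in> sets M" and "disjoint_family_on B {L..R}"
  obtains w where "\<And>n. bdd 1 (w n)" "\<And>n x. 0 \<le> w n x"
    "\<And>n x. x \<in> space M \<Longrightarrow> w n x \<le> indicator (B n) x"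
    "\<And>x. x \<in> space M \<Longrightarrow> (\<Sum>n\<in>{L..R}. push (p n) (w n) x) \<le> 1"
    "prob (\<Union>n\<in>{L..R}. B n) \<le> (1 + C) * (\<Sum>n\<in>{L..R}. \<integral>x. w n x \<partial>M)"
  using that[of "cover_weight B R"] bdd_cover_weight[of B R] cover_weight_nonneg[of B R]
    cover_weight_le_indicator[of B _ R] cover_load_le_1[of B _ R L] cover_weight_total[of B L R] assms
  by blast

end

context haar_action
begin

lemma pull_sum:
  assumes "integrable \<mu> h" "\<And>i. i \<in> I \<Longrightarrow> bdd (B i) (F i)" "x \<in> space M"
  shows "pull h (\<lambda>x. \<Sum>i\<in>I. F i x) x = (\<Sum>i\<in>I. pull h (F i) x)"
  unfolding pull_def sum_distrib_left
  by (rule Bochner_Integration.integral_sum) (rule integrable_pull[OF assms(1,2,3)])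

lemma abs_push_le:
  assumes k: "integrable \<mu> k" "\<And>g. \<bar>h g\<bar> \<le> k g" and w: "bdd B w" "\<And>x. x \<in> space M \<Longrightarrow> 0 \<le> w x"
    and x: "x \<in> space M" and h: "integrable \<mu> h"
  shows "\<bar>push h w x\<bar> \<le> push k w x"
proof -
  have "\<bar>push h w x\<bar> \<le> (\<integral>g. \<bar>h g * w (act (- g) x)\<bar> \<partial>\<mu>)"
    unfolding push_def using integral_norm_bound[of \<mu> "\<lambda>g. h g * w (act (- g) x)"] by simp
  also have "\<dots> \<le> push k w x"
    unfolding push_def
    using integrable_abs[OF integrable_push[OF h w(1) x]] integrable_push[OF k(1) w(1) x] k(2) w(2) x
    by (intro integral_mono) (auto simp: abs_mult intro!: mult_right_mono)
  finally show ?thesis .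
qed

end

section \<open>Tiles and their asymptotic orthogonality\<close>

text \<open>
  The last assumption is the condition on \<open>c\<close> in terms of the exceptional set \<open>S\<close> of shifts, whose
  relative measure in \<open>\<Phi>\<^sub>n\<close> is eventually at most \<open>\<delta>\<close>.
\<close>

locale self_orthogonal = tempered_kernels M act \<mu> p q C
  for M :: "'x measure"
    and act :: "'g::{topological_group_add, second_countable_topology, t2_space} \<Rightarrow> 'x \<Rightarrow> 'x"
    and \<mu> :: "'g measure" and p q :: "nat \<Rightarrow> 'g \<Rightarrow> real" and C :: real +
  fixes c :: "'g \<Rightarrow> real"
  assumes c_measurable [measurable]: "c \<in> borel_measurable \<mu>"
    and c_le_1: "\<bar>c g\<bar> \<le> 1"
    and p_folner: "(\<lambda>n. \<integral>a. \<bar>p n (g + a) - p n a\<bar> \<partial>\<mu>) \<longlonglongrightarrow> 0"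
    and correlations: "0 < \<delta> \<Longrightarrow> \<exists>L. \<forall>R\<ge>L. \<exists>S\<in>sets \<mu>.
          (\<forall>\<^sub>F n in sequentially. (\<integral>a. p n a * indicator S a \<partial>\<mu>) \<le> \<delta>) \<and>
          (\<forall>a. a \<notin> S \<longrightarrow> (\<forall>i\<in>{L..R}. \<bar>\<integral>g. p i g * (c g * c (g + a)) \<partial>\<mu>\<bar> \<le> \<delta>))"
begin

lemmas p_measurable [measurable] = borel_measurable_integrable[OF p_integrable]

definition pc :: "nat \<Rightarrow> 'g \<Rightarrow> real" where "pc n g = p n g * c g"

text \<open>
  For the uniform density on \<open>\<Phi>\<^sub>n\<close> this is the relative measure of the symmetric difference of
  \<open>g\<inverse>\<Phi>\<^sub>n\<close> and \<open>\<Phi>\<^sub>n\<close>.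
\<close>

definition drift :: "nat \<Rightarrow> 'g \<Rightarrow> real" where
  "drift n g = (\<integral>a. \<bar>p n (g + a) - p n a\<bar> \<partial>\<mu>)"

definition corr :: "nat \<Rightarrow> 'g \<Rightarrow> real" where
  "corr n a = (\<integral>g. p n g * (c g * c (g + a)) \<partial>\<mu>)"

lemma pc_integrable: "integrable \<mu> (pc n)"
  unfolding pc_def by (rule integrable_times_bounded[OF p_integrable _ c_le_1]) simp

lemma abs_pc_le: "\<bar>pc n g\<bar> \<le> p n g"
  using mult_left_mono[OF c_le_1[of g] p_nonneg[of n g]] by (simp add: pc_def abs_mult p_nonneg)

lemma c_mult_le_1: "\<bar>t\<bar> \<le> 1 \<Longrightarrow> \<bar>c g * t\<bar> \<le> 1"
  using mult_mono[OF c_le_1[of g], of "\<bar>t\<bar>" 1] by (simp add: abs_mult)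

lemma integrable_p_times:
  "k \<in> borel_measurable \<mu> \<Longrightarrow> (\<And>g. \<bar>k g\<bar> \<le> B) \<Longrightarrow> integrable \<mu> (\<lambda>g. p n g * k g)"
  by (rule integrable_times_bounded[OF p_integrable])

lemma abs_integral_p_times_le:
  assumes "k \<in> borel_measurable \<mu>" "\<And>g. \<bar>k g\<bar> \<le> B"
  shows "\<bar>\<integral>g. p n g * k g \<partial>\<mu>\<bar> \<le> B"
proof -
  have "\<bar>\<integral>g. p n g * k g \<partial>\<mu>\<bar> \<le> (\<integral>g. \<bar>p n g * k g\<bar> \<partial>\<mu>)"
    using integral_norm_bound[of \<mu> "\<lambda>g. p n g * k g"] by simp
  also have "\<dots> \<le> (\<integral>g. p n g * B \<partial>\<mu>)"
    using integrable_abs[OF integrable_p_times[OF assms]] p_integrable assms(2)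
    by (intro integral_mono) (auto simp: abs_mult p_nonneg intro!: mult_left_mono)
  finally show ?thesis by (simp add: p_mass)
qed

lemma drift_measurable [measurable]: "drift n \<in> borel_measurable \<mu>"
  unfolding drift_def by measurable

lemma corr_measurable [measurable]: "corr n \<in> borel_measurable \<mu>"
  unfolding corr_def by measurable

lemma abs_corr_le_1: "\<bar>corr n a\<bar> \<le> 1"
  unfolding corr_def by (intro abs_integral_p_times_le c_mult_le_1 c_le_1) measurable

lemma drift_nonneg: "0 \<le> drift n g"
  unfolding drift_def by (intro Bochner_Integration.integral_nonneg) auto

lemma drift_le_2: "drift n g \<le> 2"
proof -
  have i: "integrable \<mu> (\<lambda>a. p n (g + a))" by (rule integrable_translate[OF p_integrable])
  have "drift n g \<le> (\<integral>a. p n (g + a) + p n a \<partial>\<mu>)"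
    unfolding drift_def using i p_integrable
    by (intro integral_mono) (auto simp: abs_le_iff p_nonneg add_increasing add_increasing2)
  also have "\<dots> = 2"
    using i p_integrable integral_translate[of "p n" g] by (simp add: p_mass)
  finally show ?thesis .
qed

text \<open>
  Dominated convergence, with the bound \<open>2\<close> on the drift.
\<close>

lemma mean_drift_tendsto_0: "(\<lambda>n. \<integral>g. p i g * drift n g \<partial>\<mu>) \<longlonglongrightarrow> 0"
proof -
  have "(\<lambda>n. \<integral>g. p i g * drift n g \<partial>\<mu>) \<longlonglongrightarrow> (\<integral>g. 0 \<partial>\<mu>)"
  proof (rule integral_dominated_convergence[where w = "\<lambda>g. 2 * p i g"])
    show "AE g in \<mu>. (\<lambda>n. p i g * drift n g) \<longlonglongrightarrow> 0"
      using tendsto_mult_right_zero[OF p_folner] by (auto simp: drift_def)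
    show "AE g in \<mu>. norm (p i g * drift n g) \<le> 2 * p i g" for n
      using mult_left_mono[OF drift_le_2 p_nonneg]
      by (simp add: abs_mult p_nonneg drift_nonneg mult.commute)
  qed (use p_integrable in auto)
  then show ?thesis by simp
qed

text \<open>
  The left-hand average is a double integral over \<open>g\<close> and \<open>k\<close>, with weights \<open>p n g\<close> and \<open>p i k\<close>. The
  substitution \<open>g = ka\<close> turns its argument \<open>k\<inverse>gy\<close> into \<open>ay\<close>, which no longer depends on \<open>k\<close>. Replacing the remaining
  weight \<open>p n (ka)\<close> by \<open>p n a\<close> costs the mean drift, and then the integral over \<open>k\<close> sees only \<open>c(k) c(ka)\<close>.
\<close>

lemma pull_push_approx:
  assumes w: "bdd 1 w" and y: "y \<in> space M"
  shows "\<bar>pull (pc n) (push (pc i) w) y - (\<integral>a. p n a * (w (act a y) * corr i a) \<partial>\<mu>)\<bar>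
           \<le> (\<integral>g. p i g * drift n g \<partial>\<mu>)"
proof -
  note [measurable] = bdd_measurable[OF w]
  have w1: "\<bar>w (act a y)\<bar> \<le> 1" for a using bddD[OF w] y by simp
  have my [measurable]: "(\<lambda>a. w (act a y)) \<in> borel_measurable \<mu>" using y by measurable
  have my2 [measurable]: "(\<lambda>(g, k). w (act (- k + g) y)) \<in> borel_measurable (\<mu> \<Otimes>\<^sub>M \<mu>)"
    using y by measurable
  have my3 [measurable]: "(\<lambda>(k, a). w (act a y)) \<in> borel_measurable (\<mu> \<Otimes>\<^sub>M \<mu>)"
    using y by measurable
  \<comment> \<open>The integral over \<open>g\<close> for fixed \<open>k\<close> after the substitution, and the same with \<open>p n\<close> untranslated.\<close>
  define J where "J k = (\<integral>a. p n (k + a) * (c (k + a) * w (act a y)) \<partial>\<mu>)" for k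
  define J' where "J' k = (\<integral>a. p n a * (c (k + a) * w (act a y)) \<partial>\<mu>)" for k
  have [measurable]: "J \<in> borel_measurable \<mu>" "J' \<in> borel_measurable \<mu>"
    unfolding J_def J'_def by measurable
  have J_eq: "J k = (\<integral>g. p n g * (c g * w (act (- k + g) y)) \<partial>\<mu>)" for k
  proof -
    have "J k = (\<integral>a. p n (k + a) * (c (k + a) * w (act (- k + (k + a)) y)) \<partial>\<mu>)"
      unfolding J_def by (simp add: add.assoc[symmetric])
    also have "\<dots> = (\<integral>g. p n g * (c g * w (act (- k + g) y)) \<partial>\<mu>)"
      using y by (intro integral_translate) measurable
    finally show ?thesis .
  qed
  have mk [measurable]: "(\<lambda>g. w (act (- k + g) y)) \<in> borel_measurable \<mu>" for k
    using y by measurable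
  have J1: "\<bar>J k\<bar> \<le> 1" for k
    unfolding J_eq using bddD[OF w] y by (intro abs_integral_p_times_le c_mult_le_1) auto
  have J'1: "\<bar>J' k\<bar> \<le> 1" for k
    unfolding J'_def using w1 by (intro abs_integral_p_times_le c_mult_le_1) auto
  have intJ: "integrable \<mu> (\<lambda>k. p i k * (c k * J k))" "integrable \<mu> (\<lambda>k. p i k * (c k * J' k))"
    by (intro integrable_p_times[where B = 1] c_mult_le_1 J1 J'1; measurable)+

  have i1: "integrable (\<mu> \<Otimes>\<^sub>M \<mu>) (\<lambda>(g, k). p n g * p i k * (c g * (c k * w (act (- k + g) y))))"
    by (rule GG.integrable_tensor_times_bounded[where B = 1])
       (use p_integrable y in \<open>auto intro!: c_mult_le_1 bddD[OF w]\<close>)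
  have "pull (pc n) (push (pc i) w) y
      = (\<integral>g. (\<integral>k. p n g * p i k * (c g * (c k * w (act (- k + g) y))) \<partial>\<mu>) \<partial>\<mu>)"
    using y by (simp add: pull_def push_def pc_def act_plus mult_ac flip: integral_mult_right_zero)
  also have "\<dots> = (\<integral>k. (\<integral>g. p n g * p i k * (c g * (c k * w (act (- k + g) y))) \<partial>\<mu>) \<partial>\<mu>)"
    by (rule GG.Fubini_integral[OF i1, symmetric])
  also have "\<dots> = (\<integral>k. p i k * (c k * J k) \<partial>\<mu>)"
    by (simp add: J_eq mult_ac flip: integral_mult_right_zero)
  finally have 1: "pull (pc n) (push (pc i) w) y = (\<integral>k. p i k * (c k * J k) \<partial>\<mu>)" .

  have i2: "integrable (\<mu> \<Otimes>\<^sub>M \<mu>) (\<lambda>(k, a). p i k * p n a * (c k * (c (k + a) * w (act a y))))"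
    by (rule GG.integrable_tensor_times_bounded[where B = 1])
       (use p_integrable y in \<open>auto intro!: c_mult_le_1 bddD[OF w]\<close>)
  have "(\<integral>a. p n a * (w (act a y) * corr i a) \<partial>\<mu>)
      = (\<integral>a. (\<integral>k. p i k * p n a * (c k * (c (k + a) * w (act a y))) \<partial>\<mu>) \<partial>\<mu>)"
    by (simp add: corr_def mult_ac flip: integral_mult_right_zero)
  also have "\<dots> = (\<integral>k. (\<integral>a. p i k * p n a * (c k * (c (k + a) * w (act a y))) \<partial>\<mu>) \<partial>\<mu>)"
    by (rule GG.Fubini_integral[OF i2])
  also have "\<dots> = (\<integral>k. p i k * (c k * J' k) \<partial>\<mu>)"
    by (simp add: J'_def mult_ac flip: integral_mult_right_zero)
  finally have 2: "(\<integral>a. p n a * (w (act a y) * corr i a) \<partial>\<mu>) = (\<integral>k. p i k * (c k * J' k) \<partial>\<mu>)" .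

  have diff: "\<bar>J k - J' k\<bar> \<le> drift n k" for k
  proof -
    have i3: "integrable \<mu> (\<lambda>a. p n (k + a) * (c (k + a) * w (act a y)))"
      "integrable \<mu> (\<lambda>a. p n a * (c (k + a) * w (act a y)))"
      using w1 by (intro integrable_times_bounded[where B = 1] integrable_translate p_integrable
          c_mult_le_1; simp)+
    have i4: "integrable \<mu> (\<lambda>a. \<bar>p n (k + a) - p n a\<bar>)"
      using integrable_translate[OF p_integrable] p_integrable by auto
    have "J k - J' k = (\<integral>a. (p n (k + a) - p n a) * (c (k + a) * w (act a y)) \<partial>\<mu>)"
      unfolding J_def J'_def by (simp add: left_diff_distrib Bochner_Integration.integral_diff[OF i3])
    then have "\<bar>J k - J' k\<bar> \<le> (\<integral>a. \<bar>(p n (k + a) - p n a) * (c (k + a) * w (act a y))\<bar> \<partial>\<mu>)"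
      using integral_norm_bound[of \<mu> "\<lambda>a. (p n (k + a) - p n a) * (c (k + a) * w (act a y))"] by simp
    also have "\<dots> \<le> drift n k"
      unfolding drift_def
    proof (rule integral_mono[OF _ i4])
      show "integrable \<mu> (\<lambda>a. \<bar>(p n (k + a) - p n a) * (c (k + a) * w (act a y))\<bar>)"
        using Bochner_Integration.integrable_diff[OF i3] by (simp add: left_diff_distrib)
      show "\<bar>(p n (k + a) - p n a) * (c (k + a) * w (act a y))\<bar> \<le> \<bar>p n (k + a) - p n a\<bar>" for a
        using mult_left_mono[OF c_mult_le_1[OF w1[of a], of "k + a"], of "\<bar>p n (k + a) - p n a\<bar>"]
        by (simp add: abs_mult)
    qed
    finally show ?thesis .
  qed
  have "\<bar>(\<integral>k. p i k * (c k * J k) \<partial>\<mu>) - (\<integral>k. p i k * (c k * J' k) \<partial>\<mu>)\<bar>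
      = \<bar>\<integral>k. p i k * (c k * (J k - J' k)) \<partial>\<mu>\<bar>"
    by (simp add: right_diff_distrib Bochner_Integration.integral_diff[OF intJ])
  also have "\<dots> \<le> (\<integral>k. \<bar>p i k * (c k * (J k - J' k))\<bar> \<partial>\<mu>)"
    using integral_norm_bound[of \<mu> "\<lambda>k. p i k * (c k * (J k - J' k))"] by simp
  also have "\<dots> \<le> (\<integral>k. p i k * drift n k \<partial>\<mu>)"
  proof (rule integral_mono)
    show "integrable \<mu> (\<lambda>k. \<bar>p i k * (c k * (J k - J' k))\<bar>)"
      using Bochner_Integration.integrable_diff[OF intJ] by (simp add: right_diff_distrib)
    show "integrable \<mu> (\<lambda>k. p i k * drift n k)"
      using drift_le_2 by (intro integrable_p_times[where B = 2]) (auto simp: drift_nonneg)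
    fix k
    have "\<bar>c k\<bar> * \<bar>J k - J' k\<bar> \<le> 1 * drift n k" by (intro mult_mono c_le_1 diff) auto
    then show "\<bar>p i k * (c k * (J k - J' k))\<bar> \<le> p i k * drift n k"
      by (simp add: abs_mult p_nonneg mult_left_mono)
  qed
  finally show ?thesis by (simp add: 1 2)
qed

text \<open>
  This is the function \<open>V\<close> of the introduction.
\<close>

definition tile :: "nat \<Rightarrow> nat \<Rightarrow> (nat \<Rightarrow> 'x \<Rightarrow> real) \<Rightarrow> 'x \<Rightarrow> real" where
  "tile L R w x = (\<Sum>i\<in>{L..R}. push (pc i) (w i) x)"

text \<open>
  The bound \<open>3\<delta>\<close> has three sources: the drift, summed over the finitely many indices of the tile; the
  correlations at shifts outside the exceptional set; and the trivial bound \<open>1\<close> on the exceptional set itself.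
\<close>

lemma tile_asymptotically_orthogonal:
  assumes \<delta>: "0 < \<delta>"
  shows "\<exists>L. \<forall>R\<ge>L. \<forall>\<^sub>F n in sequentially. \<forall>w.
    (\<forall>i. bdd 1 (w i)) \<longrightarrow> (\<forall>x\<in>space M. (\<Sum>i\<in>{L..R}. \<bar>w i x\<bar>) \<le> 1) \<longrightarrow>
    (\<forall>y\<in>space M. \<bar>pull (pc n) (tile L R w) y\<bar> \<le> 3 * \<delta>)"
proof -
  obtain L where L: "\<And>R. L \<le> R \<Longrightarrow> \<exists>S\<in>sets \<mu>.
      (\<forall>\<^sub>F n in sequentially. (\<integral>a. p n a * indicator S a \<partial>\<mu>) \<le> \<delta>) \<and>
      (\<forall>a. a \<notin> S \<longrightarrow> (\<forall>i\<in>{L..R}. \<bar>\<integral>g. p i g * (c g * c (g + a)) \<partial>\<mu>\<bar> \<le> \<delta>))"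
    using correlations[OF \<delta>] by blast
  show ?thesis
  proof (intro exI[of _ L] allI impI)
    fix R assume "L \<le> R"
    from L[OF this] obtain S where [measurable]: "S \<in> sets \<mu>"
      and S: "\<forall>\<^sub>F n in sequentially. (\<integral>a. p n a * indicator S a \<partial>\<mu>) \<le> \<delta>"
        "\<And>a i. a \<notin> S \<Longrightarrow> i \<in> {L..R} \<Longrightarrow> \<bar>corr i a\<bar> \<le> \<delta>"
      by (auto simp: corr_def)
    have "(\<lambda>n. \<Sum>i\<in>{L..R}. \<integral>g. p i g * drift n g \<partial>\<mu>) \<longlonglongrightarrow> 0"
      by (rule tendsto_null_sum) (rule mean_drift_tendsto_0)
    then have "\<forall>\<^sub>F n in sequentially. (\<Sum>i\<in>{L..R}. \<integral>g. p i g * drift n g \<partial>\<mu>) < \<delta>"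
      using \<delta> by (auto dest: order_tendstoD)
    with S(1) show "\<forall>\<^sub>F n in sequentially. \<forall>w.
      (\<forall>i. bdd 1 (w i)) \<longrightarrow> (\<forall>x\<in>space M. (\<Sum>i\<in>{L..R}. \<bar>w i x\<bar>) \<le> 1) \<longrightarrow>
      (\<forall>y\<in>space M. \<bar>pull (pc n) (tile L R w) y\<bar> \<le> 3 * \<delta>)"
    proof eventually_elim
      case (elim n)
      show ?case
      proof (intro allI impI ballI)
        fix w y assume w: "\<forall>i. bdd 1 (w i)" and sum1: "\<forall>x\<in>space M. (\<Sum>i\<in>{L..R}. \<bar>w i x\<bar>) \<le> 1"
          and y: "y \<in> space M"
        have wi: "bdd 1 (w i)" for i using w by simp
        note [measurable] = bdd_measurable[OF wi]
        have [measurable]: "(\<lambda>a. w i (act a y)) \<in> borel_measurable \<mu>" for i using y by measurable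
        let ?K = "\<lambda>i. \<integral>a. p n a * (w i (act a y) * corr i a) \<partial>\<mu>"
        have int: "integrable \<mu> (\<lambda>a. p n a * (w i (act a y) * corr i a))" for i
          using mult_mono[OF bddD[OF wi[of i] act_space[OF y]] abs_corr_le_1[of i]]
          by (intro integrable_p_times[where B = 1]) (auto simp: abs_mult)
        have intS: "integrable \<mu> (\<lambda>a. p n a * indicator S a)"
          by (intro integrable_p_times[where B = 1]) (auto simp: indicator_def)
        have "\<bar>pull (pc n) (tile L R w) y - (\<Sum>i\<in>{L..R}. ?K i)\<bar>
            = \<bar>\<Sum>i\<in>{L..R}. pull (pc n) (push (pc i) (w i)) y - ?K i\<bar>"
          unfolding tile_def
          by (subst pull_sum[OF pc_integrable bdd_push[OF pc_integrable wi] y]) (simp add: sum_subtractf)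
        also have "\<dots> \<le> (\<Sum>i\<in>{L..R}. \<integral>g. p i g * drift n g \<partial>\<mu>)"
          by (rule order_trans[OF sum_abs]) (intro sum_mono pull_push_approx wi y)
        also have "\<dots> \<le> \<delta>" using elim by simp
        finally have 1: "\<bar>pull (pc n) (tile L R w) y - (\<Sum>i\<in>{L..R}. ?K i)\<bar> \<le> \<delta>" .
        have pt: "\<bar>\<Sum>i\<in>{L..R}. w i (act a y) * corr i a\<bar> \<le> \<delta> + indicator S a" for a
        proof -
          have "\<bar>\<Sum>i\<in>{L..R}. w i (act a y) * corr i a\<bar>
              \<le> (\<Sum>i\<in>{L..R}. \<bar>w i (act a y)\<bar> * (\<delta> + indicator S a))"
          proof (rule order_trans[OF sum_abs], rule sum_mono)
            fix i assume i: "i \<in> {L..R}"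
            have "\<bar>corr i a\<bar> \<le> \<delta> + indicator S a"
              using S(2)[OF _ i, of a] abs_corr_le_1[of i a] \<delta> by (cases "a \<in> S") auto
            then show "\<bar>w i (act a y) * corr i a\<bar> \<le> \<bar>w i (act a y)\<bar> * (\<delta> + indicator S a)"
              by (simp add: abs_mult mult_left_mono)
          qed
          also have "\<dots> = (\<Sum>i\<in>{L..R}. \<bar>w i (act a y)\<bar>) * (\<delta> + indicator S a)"
            by (simp add: sum_distrib_right)
          also have "\<dots> \<le> 1 * (\<delta> + indicator S a)"
            using sum1 y \<delta> by (intro mult_right_mono) auto
          finally show ?thesis by simp
        qed
        have "(\<Sum>i\<in>{L..R}. ?K i) = (\<integral>a. (\<Sum>i\<in>{L..R}. p n a * (w i (act a y) * corr i a)) \<partial>\<mu>)"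
          using int by simp
        also have "\<bar>\<dots>\<bar> \<le> (\<integral>a. \<bar>\<Sum>i\<in>{L..R}. p n a * (w i (act a y) * corr i a)\<bar> \<partial>\<mu>)"
          using integral_norm_bound[of \<mu> "\<lambda>a. \<Sum>i\<in>{L..R}. p n a * (w i (act a y) * corr i a)"] by simp
        also have "\<dots> \<le> (\<integral>a. \<delta> * p n a + p n a * indicator S a \<partial>\<mu>)"
        proof (rule integral_mono)
          show "\<bar>\<Sum>i\<in>{L..R}. p n a * (w i (act a y) * corr i a)\<bar> \<le> \<delta> * p n a + p n a * indicator S a" for a
            using mult_left_mono[OF pt[of a] p_nonneg[of n a]]
            by (simp add: sum_distrib_left[symmetric] abs_mult p_nonneg algebra_simps)
        qed (use int intS p_integrable in auto)
        also have "\<dots> = \<delta> + (\<integral>a. p n a * indicator S a \<partial>\<mu>)"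
          using intS p_integrable by (simp add: p_mass)
        also have "\<dots> \<le> 2 * \<delta>" using elim by simp
        finally show "\<bar>pull (pc n) (tile L R w) y\<bar> \<le> 3 * \<delta>" using 1 by linarith
      qed
    qed
  qed
qed

end

section \<open>Decreasing the energy\<close>

context self_orthogonal
begin

lemma bdd_tile:
  assumes w: "\<And>i. bdd 1 (w i)" "\<And>i x. 0 \<le> w i x"
    and load: "\<And>x. x \<in> space M \<Longrightarrow> (\<Sum>n\<in>{L..R}. push (p n) (w n) x) \<le> 1"
  shows "bdd 1 (tile L R w)"
proof -
  have "bdd (\<Sum>i\<in>{L..R}. (\<integral>g. \<bar>pc i g\<bar> \<partial>\<mu>) * 1) (tile L R w)"
    unfolding tile_def by (rule bdd_sum) (rule bdd_push[OF pc_integrable w(1)])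
  moreover have "\<bar>tile L R w x\<bar> \<le> 1" if x: "x \<in> space M" for x
  proof -
    have "\<bar>tile L R w x\<bar> \<le> (\<Sum>n\<in>{L..R}. push (p n) (w n) x)"
      unfolding tile_def
      by (rule order_trans[OF sum_abs])
         (rule sum_mono, rule abs_push_le[OF p_integrable abs_pc_le w(1,2) x pc_integrable])
    then show ?thesis using load[OF x] by linarith
  qed
  ultimately show ?thesis by (auto simp: bdd_def)
qed

text \<open>
  \<open>L\<close> is dictated by the correlations of \<open>c\<close>, and \<open>R\<close> is taken so large that half of \<open>E\<close> sees an average above \<open>\<epsilon>\<close> at
  some index between \<open>L\<close> and \<open>R\<close>. Sorting these points by their first such index gives disjoint sets,
  to which the fractional covering applies.
\<close>

lemma correlating_tile:
  assumes E [measurable]: "E \<in> sets M" and E_pos: "0 < prob E" and F: "bdd B F" and \<epsilon>: "0 < \<epsilon>"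
    and big: "\<And>x. x \<in> E \<Longrightarrow> \<exists>\<^sub>F n in sequentially. \<epsilon> < pull (pc n) F x" and \<delta>: "0 < \<delta>"
  obtains V where "bdd 1 V" "\<epsilon> * prob E / (2 * (1 + C)) \<le> (\<integral>x. F x * V x \<partial>M)"
    "\<forall>\<^sub>F n in sequentially. \<forall>y\<in>space M. \<bar>pull (pc n) V y\<bar> \<le> 3 * \<delta>"
proof -
  obtain L where L: "\<And>R. L \<le> R \<Longrightarrow> \<forall>\<^sub>F n in sequentially. \<forall>w.
    (\<forall>i. bdd 1 (w i)) \<longrightarrow> (\<forall>x\<in>space M. (\<Sum>i\<in>{L..R}. \<bar>w i x\<bar>) \<le> 1) \<longrightarrow>
    (\<forall>y\<in>space M. \<bar>pull (pc n) (tile L R w) y\<bar> \<le> 3 * \<delta>)"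
    using tile_asymptotically_orthogonal[OF \<delta>] by blast
  have pull_bdd: "bdd ((\<integral>g. \<bar>pc n g\<bar> \<partial>\<mu>) * B) (pull (pc n) F)" for n
    by (rule bdd_pull[OF pc_integrable F])
  note [measurable] = bdd_measurable[OF pull_bdd]
  define D where "D n = {x \<in> space M. \<epsilon> < pull (pc n) F x}" for n
  have [measurable]: "D n \<in> sets M" for n unfolding D_def by measurable
  define U where "U R = E \<inter> (\<Union>n\<in>{L..R}. D n)" for R
  have "(\<lambda>R. prob (U R)) \<longlonglongrightarrow> prob (\<Union>R. U R)"
  proof (rule finite_Lim_measure_incseq)
    show "range U \<subseteq> sets M" by (auto simp: U_def)
    show "incseq U" by (force simp: incseq_def U_def)
  qed
  moreover have "(\<Union>R. U R) = E"
  proof -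
    have "\<exists>R. x \<in> U R" if "x \<in> E" for x
    proof -
      obtain n where "L \<le> n" "\<epsilon> < pull (pc n) F x"
        using big[OF \<open>x \<in> E\<close>] by (auto simp: frequently_sequentially)
      then show ?thesis using \<open>x \<in> E\<close> sets.sets_into_space[OF E] by (auto simp: U_def D_def intro!: exI[of _ n])
    qed
    then show ?thesis by (auto simp: U_def)
  qed
  ultimately have "\<forall>\<^sub>F R in sequentially. prob E / 2 < prob (U R)"
    using E_pos by (intro order_tendstoD(1)[where y = "prob E"]) auto
  from eventually_conj[OF this eventually_ge_at_top[of L]]
  obtain R where R: "prob E / 2 < prob (U R)" "L \<le> R"
    by (auto dest: eventually_happens)

  \<comment> \<open>The points whose first large average from \<open>L\<close> on has index \<open>n\<close>.\<close>
  define S where "S n = (if n < L then {} else D n - (\<Union>i\<in>{L..<n}. D i))" for n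
  have S_sets [measurable]: "S n \<in> sets M" for n by (simp add: S_def)
  have S_disj: "disjoint_family_on S {L..R}"
    unfolding disjoint_family_on_def
  proof (intro ballI impI)
    fix m n assume "m \<in> {L..R}" "n \<in> {L..R}" "m \<noteq> n"
    then show "S m \<inter> S n = {}"
      by (cases m n rule: linorder_cases) (auto simp: S_def)
  qed
  have S_UN: "(\<Union>n\<in>{L..R}. D n) \<subseteq> (\<Union>n\<in>{L..R}. S n)"
  proof
    fix x assume "x \<in> (\<Union>n\<in>{L..R}. D n)"
    then obtain n where n: "n \<in> {L..R}" "x \<in> D n" by auto
    define m where "m = (LEAST m. L \<le> m \<and> x \<in> D m)"
    have m: "L \<le> m" "x \<in> D m" "m \<le> n"
      using LeastI[of "\<lambda>m. L \<le> m \<and> x \<in> D m" n] Least_le[of "\<lambda>m. L \<le> m \<and> x \<in> D m" n] n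
      by (auto simp: m_def)
    have "x \<notin> D i" if "i \<in> {L..<m}" for i
      using not_less_Least[of i "\<lambda>m. L \<le> m \<and> x \<in> D m"] that by (auto simp: m_def)
    then have "x \<in> S m" using m by (auto simp: S_def)
    then show "x \<in> (\<Union>n\<in>{L..R}. S n)" using m n by auto
  qed
  have "prob (U R) \<le> prob (\<Union>n\<in>{L..R}. S n)"
    using S_UN by (intro finite_measure_mono) (auto simp: U_def)
  with R have S_prob: "prob E / 2 \<le> prob (\<Union>n\<in>{L..R}. S n)" by linarith

  obtain w where w: "\<And>n. bdd 1 (w n)" "\<And>n x. 0 \<le> w n x"
    "\<And>n x. x \<in> space M \<Longrightarrow> w n x \<le> indicator (S n) x"
    and load: "\<And>x. x \<in> space M \<Longrightarrow> (\<Sum>n\<in>{L..R}. push (p n) (w n) x) \<le> 1"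
    and total: "prob (\<Union>n\<in>{L..R}. S n) \<le> (1 + C) * (\<Sum>n\<in>{L..R}. \<integral>x. w n x \<partial>M)"
    using fractional_covering[OF S_sets S_disj] by blast
  have sum1: "(\<Sum>i\<in>{L..R}. \<bar>w i x\<bar>) \<le> 1" if x: "x \<in> space M" for x
  proof -
    have "(\<Sum>i\<in>{L..R}. \<bar>w i x\<bar>) \<le> (\<Sum>i\<in>{L..R}. indicator (S i) x)"
      using w x by (intro sum_mono) auto
    also have "\<dots> = indicator (\<Union>n\<in>{L..R}. S n) x"
      using S_disj by (intro indicator_UN_disjoint[symmetric]) auto
    also have "\<dots> \<le> 1" by (simp add: indicator_def)
    finally show ?thesis .
  qed

  have int_push: "integrable M (\<lambda>x. F x * push (pc n) (w n) x)" for n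
    by (rule bdd_integrable[OF bdd_mult[OF F bdd_push[OF pc_integrable w(1)]]])
  have corr_n: "\<epsilon> * (\<integral>x. w n x \<partial>M) \<le> (\<integral>x. F x * push (pc n) (w n) x \<partial>M)" for n
  proof -
    have "\<epsilon> * w n x \<le> w n x * pull (pc n) F x" if x: "x \<in> space M" for x
    proof (cases "x \<in> S n")
      case True
      then have "\<epsilon> \<le> pull (pc n) F x" by (auto simp: S_def D_def split: if_splits)
      from mult_left_mono[OF this w(2)[of n x]] show ?thesis by (simp add: mult.commute)
    next
      case False then show ?thesis using w(2)[of n x] w(3)[OF x, of n] by simp
    qed
    then have "(\<integral>x. \<epsilon> * w n x \<partial>M) \<le> (\<integral>x. w n x * pull (pc n) F x \<partial>M)"
      using bdd_integrable[OF w(1)] bdd_integrable[OF bdd_mult[OF w(1) pull_bdd]]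
      by (intro integral_mono) auto
    then show ?thesis by (simp add: push_dual_pull[OF pc_integrable F w(1)])
  qed
  have "prob E \<le> (2 * (1 + C)) * (\<Sum>n\<in>{L..R}. \<integral>x. w n x \<partial>M)"
    using S_prob total unfolding mult.assoc by linarith
  then have "prob E / (2 * (1 + C)) \<le> (\<Sum>n\<in>{L..R}. \<integral>x. w n x \<partial>M)"
    using C_nonneg by (simp add: divide_le_eq mult.commute)
  then have "\<epsilon> * prob E / (2 * (1 + C)) \<le> \<epsilon> * (\<Sum>n\<in>{L..R}. \<integral>x. w n x \<partial>M)"
    using \<epsilon> mult_left_mono[of _ _ \<epsilon>] by fastforce
  also have "\<dots> \<le> (\<Sum>n\<in>{L..R}. \<integral>x. F x * push (pc n) (w n) x \<partial>M)"
    by (simp add: sum_distrib_left sum_mono corr_n)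
  also have "\<dots> = (\<integral>x. F x * tile L R w x \<partial>M)"
    unfolding tile_def sum_distrib_left using int_push by simp
  finally have "\<epsilon> * prob E / (2 * (1 + C)) \<le> (\<integral>x. F x * tile L R w x \<partial>M)" .
  moreover have "\<forall>\<^sub>F n in sequentially. \<forall>y\<in>space M. \<bar>pull (pc n) (tile L R w) y\<bar> \<le> 3 * \<delta>"
    using L[OF R(2)] by eventually_elim (use w(1) sum1 in auto)
  ultimately show ?thesis using that bdd_tile[OF w(1,2) load] by blast
qed

text \<open>
  Subtracting \<open>\<rho>V\<close> changes the energy by \<open>- 2\<rho>\<integral>GV + \<rho>\<^sup>2\<integral>V\<^sup>2 \<le> - \<rho>\<^sup>2\<close>. The gain \<open>\<rho>\<close> is the same in every step because it
  depends on the current function only through the level \<open>\<epsilon>/2\<close>.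
\<close>

lemma no_positive_upper_average:
  assumes E: "E \<in> sets M" and F: "bdd B F" and \<epsilon>: "0 < \<epsilon>"
    and big: "\<And>x. x \<in> E \<Longrightarrow> \<exists>\<^sub>F n in sequentially. \<epsilon> < pull (pc n) F x"
  shows "prob E = 0"
proof (rule ccontr)
  assume "prob E \<noteq> 0"
  then have E_pos: "0 < prob E" by (simp add: zero_less_measure_iff)
  define \<rho> where "\<rho> = \<epsilon> / 2 * prob E / (2 * (1 + C))"
  have \<rho>: "0 < \<rho>" using E_pos \<epsilon> C_nonneg by (simp add: \<rho>_def)
  obtain K :: nat where K: "(\<integral>x. F x * F x \<partial>M) / \<rho>\<^sup>2 < real K" using reals_Archimedean2 by blast
  have "0 \<le> (\<integral>x. F x * F x \<partial>M) / \<rho>\<^sup>2"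
    by (intro divide_nonneg_nonneg Bochner_Integration.integral_nonneg) auto
  with K have K0: "0 < real K" by linarith
  \<comment> \<open>Each of the \<open>K\<close> steps changes the averages by at most \<open>3\<delta>\<rho>\<close>. All of them together leave \<open>\<epsilon>/2\<close>,
    the level for which \<open>\<rho>\<close> is computed.\<close>
  define \<delta> where "\<delta> = \<epsilon> / (6 * \<rho> * K)"
  have \<delta>: "0 < \<delta>" using \<epsilon> \<rho> K0 by (simp add: \<delta>_def)
  have K\<delta>: "real K * (3 * \<delta> * \<rho>) = \<epsilon> / 2" using K0 \<rho> by (simp add: \<delta>_def field_simps)
  have "\<exists>G B. bdd B G \<and> (\<integral>x. G x * G x \<partial>M) \<le> (\<integral>x. F x * F x \<partial>M) - real k * \<rho>\<^sup>2 \<and>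
      (\<forall>x\<in>E. \<exists>\<^sub>F n in sequentially. \<epsilon> - real k * (3 * \<delta> * \<rho>) < pull (pc n) G x)"
    if "k \<le> K" for k
    using that
  proof (induction k)
    case 0
    show ?case using F big by (intro exI[of _ F] exI[of _ B]) auto
  next
    case (Suc k)
    then obtain G B where G: "bdd B G"
      and energy: "(\<integral>x. G x * G x \<partial>M) \<le> (\<integral>x. F x * F x \<partial>M) - real k * \<rho>\<^sup>2"
      and G_big: "\<And>x. x \<in> E \<Longrightarrow> \<exists>\<^sub>F n in sequentially. \<epsilon> - real k * (3 * \<delta> * \<rho>) < pull (pc n) G x"
      by auto
    have "real k * (3 * \<delta> * \<rho>) \<le> real K * (3 * \<delta> * \<rho>)"
      using Suc.prems \<delta> \<rho> by (intro mult_right_mono) auto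
    then have half: "\<epsilon> / 2 \<le> \<epsilon> - real k * (3 * \<delta> * \<rho>)" using K\<delta> by linarith
    have G_half: "\<exists>\<^sub>F n in sequentially. \<epsilon> / 2 < pull (pc n) G x" if "x \<in> E" for x
      by (rule frequently_elim1[OF G_big[OF that]]) (use half in linarith)
    from \<epsilon> have "0 < \<epsilon> / 2" by simp
    from correlating_tile[OF E E_pos G this G_half \<delta>]
    obtain V where V: "bdd 1 V" and VG: "\<rho> \<le> (\<integral>x. G x * V x \<partial>M)"
      and V_orth: "\<forall>\<^sub>F n in sequentially. \<forall>y\<in>space M. \<bar>pull (pc n) V y\<bar> \<le> 3 * \<delta>"
      by (auto simp: \<rho>_def)
    let ?G' = "\<lambda>x. G x + (- \<rho>) * V x"
    have G': "bdd (B + \<bar>- \<rho>\<bar> * 1) ?G'" by (intro bdd_add bdd_scale G V)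
    have ints: "integrable M (\<lambda>x. G x * G x)" "integrable M (\<lambda>x. G x * V x)" "integrable M (\<lambda>x. V x * V x)"
      using bdd_mult[OF G G] bdd_mult[OF G V] bdd_mult[OF V V] by (auto intro: bdd_integrable)
    have "(\<integral>x. V x * V x \<partial>M) \<le> (\<integral>x. 1 \<partial>M)"
      using bddD[OF bdd_mult[OF V V]] by (intro integral_mono ints) (auto simp: abs_le_iff)
    then have VV: "(\<integral>x. V x * V x \<partial>M) \<le> 1" by (simp add: prob_space)
    have "(\<integral>x. ?G' x * ?G' x \<partial>M)
        = (\<integral>x. G x * G x + (- 2 * \<rho>) * (G x * V x) + \<rho>\<^sup>2 * (V x * V x) \<partial>M)"
      by (rule Bochner_Integration.integral_cong) (auto simp: algebra_simps power2_eq_square)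
    also have "\<dots> = (\<integral>x. G x * G x \<partial>M) - 2 * \<rho> * (\<integral>x. G x * V x \<partial>M) + \<rho>\<^sup>2 * (\<integral>x. V x * V x \<partial>M)"
      using ints by simp
    also have "\<dots> \<le> (\<integral>x. G x * G x \<partial>M) - 2 * \<rho> * \<rho> + \<rho>\<^sup>2 * 1"
      using VG VV \<rho> by (intro add_mono diff_mono mult_left_mono) auto
    also have "\<dots> \<le> (\<integral>x. F x * F x \<partial>M) - real (Suc k) * \<rho>\<^sup>2"
      using energy by (simp add: algebra_simps power2_eq_square)
    finally have "(\<integral>x. ?G' x * ?G' x \<partial>M) \<le> (\<integral>x. F x * F x \<partial>M) - real (Suc k) * \<rho>\<^sup>2" .
    moreover have "\<exists>\<^sub>F n in sequentially. \<epsilon> - real (Suc k) * (3 * \<delta> * \<rho>) < pull (pc n) ?G' x"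
      if "x \<in> E" for x
    proof -
      have x: "x \<in> space M" using that sets.sets_into_space[OF E] by auto
      show ?thesis
      proof (rule frequently_rev_mp[OF G_big[OF that]], rule eventually_mono[OF V_orth], intro impI)
        fix n
        assume *: "\<forall>y\<in>space M. \<bar>pull (pc n) V y\<bar> \<le> 3 * \<delta>"
          and **: "\<epsilon> - real k * (3 * \<delta> * \<rho>) < pull (pc n) G x"
        have "pull (pc n) ?G' x = pull (pc n) G x - \<rho> * pull (pc n) V x"
        proof -
          have "pull (pc n) ?G' x
              = (\<integral>g. pc n g * G (act g x) - \<rho> * (pc n g * V (act g x)) \<partial>\<mu>)"
            unfolding pull_def by (simp add: algebra_simps)
          then show ?thesis
            unfolding pull_def
            using integrable_pull[OF pc_integrable G x] integrable_pull[OF pc_integrable V x] by simp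
        qed
        moreover have "\<rho> * pull (pc n) V x \<le> \<rho> * (3 * \<delta>)"
          using * x \<rho> by (intro mult_left_mono) (auto simp: abs_le_iff)
        ultimately show "\<epsilon> - real (Suc k) * (3 * \<delta> * \<rho>) < pull (pc n) ?G' x"
          using ** by (simp add: algebra_simps)
      qed
    qed
    ultimately show ?case using G' by blast
  qed
  from this[of K] obtain G where
    "(\<integral>x. G x * G x \<partial>M) \<le> (\<integral>x. F x * F x \<partial>M) - real K * \<rho>\<^sup>2" by auto
  moreover have "0 \<le> (\<integral>x. G x * G x \<partial>M)"
    by (intro Bochner_Integration.integral_nonneg) auto
  moreover have "(\<integral>x. F x * F x \<partial>M) < real K * \<rho>\<^sup>2"
    using K \<rho> by (simp add: field_simps)
  ultimately show False by linarith
qed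

lemma weighted_averages_tendsto_0:
  assumes F: "bdd B F"
  shows "AE x in M. (\<lambda>n. pull (pc n) F x) \<longlonglongrightarrow> 0"
proof -
  have upper: "AE x in M. \<forall>\<^sub>F n in sequentially. pull (pc n) G x \<le> \<epsilon>"
    if G: "bdd B G" and \<epsilon>: "0 < \<epsilon>" for G \<epsilon>
  proof -
    note [measurable] = bdd_measurable[OF bdd_pull[OF pc_integrable G]]
    define E where "E = {x \<in> space M. \<forall>N. \<exists>n\<ge>N. \<epsilon> < pull (pc n) G x}"
    have E [measurable]: "E \<in> sets M" unfolding E_def by measurable
    have "prob E = 0"
      by (rule no_positive_upper_average[OF E G \<epsilon>]) (auto simp: E_def frequently_sequentially)
    then have "AE x in M. x \<notin> E" by (intro AE_not_in) (simp add: null_sets_def emeasure_eq_measure)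
    then show ?thesis
      by (rule AE_mp) (auto intro!: AE_I2 simp: E_def eventually_sequentially not_less)
  qed
  have neg: "bdd B (\<lambda>x. - F x)" using F by (auto simp: bdd_def)
  have "AE x in M. \<forall>k::nat. (\<forall>\<^sub>F n in sequentially. pull (pc n) F x \<le> 1 / Suc k) \<and>
      (\<forall>\<^sub>F n in sequentially. pull (pc n) (\<lambda>x. - F x) x \<le> 1 / Suc k)"
    using upper[OF F] upper[OF neg] by (simp add: AE_all_countable)
  then show ?thesis
  proof (rule AE_mp, intro AE_I2 impI)
    fix x
    assume *: "\<forall>k::nat. (\<forall>\<^sub>F n in sequentially. pull (pc n) F x \<le> 1 / Suc k) \<and>
      (\<forall>\<^sub>F n in sequentially. pull (pc n) (\<lambda>x. - F x) x \<le> 1 / Suc k)"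
    show "(\<lambda>n. pull (pc n) F x) \<longlonglongrightarrow> 0"
    proof (rule tendstoI)
      fix e :: real assume "0 < e"
      then obtain k where k: "1 / real (Suc k) < e" using nat_approx_posE by blast
      from * have "\<forall>\<^sub>F n in sequentially. pull (pc n) F x \<le> 1 / Suc k"
        "\<forall>\<^sub>F n in sequentially. pull (pc n) (\<lambda>x. - F x) x \<le> 1 / Suc k" by auto
      then show "\<forall>\<^sub>F n in sequentially. dist (pull (pc n) F x) 0 < e"
      proof eventually_elim
        case (elim n)
        have "pull (pc n) (\<lambda>x. - F x) x = - pull (pc n) F x" by (simp add: pull_def)
        with elim k show ?case by (simp add: abs_less_iff)
      qed
    qed
  qed
qed

end

section \<open>Uniform averages over Folner sets\<close>

definition uniform_kernel :: "'g measure \<Rightarrow> 'g set \<Rightarrow> 'g \<Rightarrow> real" where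
  "uniform_kernel \<mu> A g = indicator A g / measure \<mu> A"

lemma average_eq_uniform_kernel:
  fixes h :: "'g \<Rightarrow> real"
  shows "average \<mu> A h = (\<integral>g. uniform_kernel \<mu> A g * h g \<partial>\<mu>)"
  by (simp add: average_def uniform_kernel_def set_lebesgue_integral_def)

lemma integrable_uniform_kernel:
  "A \<in> sets \<mu> \<Longrightarrow> emeasure \<mu> A < \<infinity> \<Longrightarrow> integrable \<mu> (uniform_kernel \<mu> A)"
  unfolding uniform_kernel_def by (intro integrable_divide) auto

lemma strong_folnerD:
  assumes "strong_folner \<mu> \<Phi>"
  shows "\<Phi> n \<in> sets \<mu>" "emeasure \<mu> (\<Phi> n) < \<infinity>" "0 < measure \<mu> (\<Phi> n)"
    "emeasure \<mu> (\<Phi> n) = ennreal (measure \<mu> (\<Phi> n))"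
proof -
  show 1: "\<Phi> n \<in> sets \<mu>" "emeasure \<mu> (\<Phi> n) < \<infinity>" using assms by (auto simp: strong_folner_def)
  then show 2: "emeasure \<mu> (\<Phi> n) = ennreal (measure \<mu> (\<Phi> n))"
    by (intro emeasure_eq_ennreal_measure) (auto simp: less_top)
  have "0 < emeasure \<mu> (\<Phi> n)" using assms by (auto simp: strong_folner_def)
  then show "0 < measure \<mu> (\<Phi> n)" by (simp add: 2)
qed

text \<open>
  The boundary of \<open>\<Phi>\<^sub>n\<close> with respect to \<open>{g, 0}\<close> contains the symmetric difference of \<open>g\<inverse>\<Phi>\<^sub>n\<close> and \<open>\<Phi>\<^sub>n\<close>, because
  \<open>0\<close> belongs to \<open>{g, 0}\<close>.
\<close>

lemma strong_folner_asymptotically_invariant: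
  fixes \<mu> :: "'g::{topological_group_add, second_countable_topology, t2_space} measure"
  assumes haar: "left_haar_measure \<mu>" and folner: "strong_folner \<mu> \<Phi>"
  shows "(\<lambda>n. \<integral>a. \<bar>uniform_kernel \<mu> (\<Phi> n) (g + a) - uniform_kernel \<mu> (\<Phi> n) a\<bar> \<partial>\<mu>) \<longlonglongrightarrow> 0"
proof -
  note \<Phi> = strong_folnerD[OF folner]
  have s [measurable_cong]: "sets \<mu> = sets borel" using haar by (simp add: left_haar_measure_def)
  have sp: "space \<mu> = UNIV" using sets_eq_imp_space_eq[OF s] by simp
  note [measurable] = \<Phi>(1)
  define T where "T n = {a. (g + a \<in> \<Phi> n) \<noteq> (a \<in> \<Phi> n)}" for n
  define P where "P n = {a. g + a \<in> \<Phi> n}" for n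
  have T_eq: "T n = (P n - \<Phi> n) \<union> (\<Phi> n - P n)" for n by (auto simp: T_def P_def)
  have P_eq: "P n = (+) g -` \<Phi> n \<inter> space \<mu>" for n by (auto simp: P_def sp)
  have [measurable]: "P n \<in> sets \<mu>" for n unfolding P_eq by measurable
  have [measurable]: "T n \<in> sets \<mu>" for n unfolding T_eq by measurable
  have "emeasure \<mu> (P n) = emeasure (distr \<mu> \<mu> ((+) g)) (\<Phi> n)" for n
    unfolding P_eq by (rule emeasure_distr[symmetric]) auto
  then have P_em: "emeasure \<mu> (P n) < \<infinity>" for n using \<Phi>(2) by (simp add: left_haar_distr[OF haar])
  have T_em: "emeasure \<mu> (T n) < \<infinity>" for n
  proof -
    have "emeasure \<mu> (T n) \<le> emeasure \<mu> (P n \<union> \<Phi> n)" by (intro emeasure_mono) (auto simp: T_eq)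
    also have "\<dots> \<le> emeasure \<mu> (P n) + emeasure \<mu> (\<Phi> n)" by (intro emeasure_subadditive) auto
    also have "\<dots> < \<infinity>" using P_em \<Phi>(2) by simp
    finally show ?thesis .
  qed
  have "(\<integral>a. \<bar>uniform_kernel \<mu> (\<Phi> n) (g + a) - uniform_kernel \<mu> (\<Phi> n) a\<bar> \<partial>\<mu>)
      = measure \<mu> (T n) / measure \<mu> (\<Phi> n)" for n
  proof -
    have "\<bar>uniform_kernel \<mu> (\<Phi> n) (g + a) - uniform_kernel \<mu> (\<Phi> n) a\<bar>
        = indicator (T n) a / measure \<mu> (\<Phi> n)" for a
      by (auto simp: uniform_kernel_def T_def indicator_def)
    then show ?thesis using sp by simp
  qed
  moreover have "(\<lambda>n. ennreal (measure \<mu> (T n) / measure \<mu> (\<Phi> n))) \<longlonglongrightarrow> 0"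
  proof (rule tendsto_sandwich[OF _ _ tendsto_const])
    have "compact {g, 0}" by simp
    then show "(\<lambda>n. outer_measure_of \<mu> (group_boundary {g, 0} (\<Phi> n)) / emeasure \<mu> (\<Phi> n)) \<longlonglongrightarrow> 0"
      using folner unfolding strong_folner_def by blast
    have "ennreal (measure \<mu> (T n) / measure \<mu> (\<Phi> n))
        \<le> outer_measure_of \<mu> (group_boundary {g, 0} (\<Phi> n)) / emeasure \<mu> (\<Phi> n)" for n
    proof -
      have "T n \<subseteq> group_boundary {g, 0} (\<Phi> n)"
      proof
        fix a assume "a \<in> T n"
        moreover have "a = - g + (g + a)" "a = - 0 + a" by (simp_all add: add.assoc[symmetric])
        ultimately show "a \<in> group_boundary {g, 0} (\<Phi> n)"
          unfolding group_boundary_def inv_prod_def T_def by blast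
      qed
      then have "emeasure \<mu> (T n) \<le> outer_measure_of \<mu> (group_boundary {g, 0} (\<Phi> n))"
        using outer_measure_of_mono[of "T n" _ \<mu>] by simp
      moreover have "ennreal (measure \<mu> (T n) / measure \<mu> (\<Phi> n)) = emeasure \<mu> (T n) / emeasure \<mu> (\<Phi> n)"
        using \<Phi>(3)[of n] T_em[of n] emeasure_eq_ennreal_measure[of \<mu> "T n"]
        by (simp add: \<Phi>(4) divide_ennreal less_top)
      ultimately show ?thesis by (simp add: divide_right_mono_ennreal)
    qed
    then show "\<forall>\<^sub>F n in sequentially. ennreal (measure \<mu> (T n) / measure \<mu> (\<Phi> n))
        \<le> outer_measure_of \<mu> (group_boundary {g, 0} (\<Phi> n)) / emeasure \<mu> (\<Phi> n)" by simp
  qed simp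
  ultimately show ?thesis by (simp add: ennreal_tendsto_0_iff)
qed

text \<open>
  The union of the sets \<open>\<Phi>\<^sub>i\<inverse>\<Phi>\<^sub>j\<close>, \<open>i < j\<close>, need not be measurable; the kernel \<open>q j\<close> is built on a measurable hull
  \<open>\<Psi> j\<close> of the same outer measure.
\<close>

lemma (in haar_action) tempered_kernels_uniform:
  assumes folner: "strong_folner \<mu> \<Phi>" and tempered: "tempered \<mu> \<Phi>"
  shows "\<exists>q C. tempered_kernels M act \<mu> (\<lambda>n. uniform_kernel \<mu> (\<Phi> n)) q C"
proof -
  note \<Phi> = strong_folnerD[OF folner]
  obtain C :: real where C: "\<And>j. outer_measure_of \<mu> (\<Union>i<j. inv_prod (\<Phi> i) (\<Phi> j)) < ennreal C * emeasure \<mu> (\<Phi> j)"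
    using tempered unfolding tempered_def by blast
  have "0 < C" using C[of 0] by (cases "0 < C") (auto simp: ennreal_neg)
  have sub: "(\<Union>i<j. inv_prod (\<Phi> i) (\<Phi> j)) \<subseteq> space \<mu>" for j by simp
  have "\<exists>E\<in>sets \<mu>. (\<Union>i<j. inv_prod (\<Phi> i) (\<Phi> j)) \<subseteq> E \<and> emeasure \<mu> E < ennreal C * emeasure \<mu> (\<Phi> j)" for j
    using outer_measure_of_attain[OF sub] C by metis
  then obtain \<Psi> where \<Psi>: "\<And>j. \<Psi> j \<in> sets \<mu>" "\<And>j. (\<Union>i<j. inv_prod (\<Phi> i) (\<Phi> j)) \<subseteq> \<Psi> j"
      "\<And>j. emeasure \<mu> (\<Psi> j) < ennreal C * emeasure \<mu> (\<Phi> j)"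
    by metis
  have fin: "emeasure \<mu> (\<Psi> j) < \<infinity>" for j using \<Psi>(3)[of j]
    by (metis infinity_ennreal_def order.strict_trans2 top_greatest)
  have mass: "measure \<mu> (\<Psi> j) \<le> C * measure \<mu> (\<Phi> j)" for j
  proof -
    have "ennreal (measure \<mu> (\<Psi> j)) \<le> ennreal (C * measure \<mu> (\<Phi> j))"
      using \<Psi>(3)[of j] fin[of j] \<open>0 < C\<close> emeasure_eq_ennreal_measure[of \<mu> "\<Psi> j"]
      by (simp add: \<Phi>(4) ennreal_mult)
    then show ?thesis using \<open>0 < C\<close> by (subst (asm) ennreal_le_iff) auto
  qed
  let ?q = "\<lambda>j g. indicator (\<Psi> j) g / measure \<mu> (\<Phi> j)"
  have "tempered_kernels M act \<mu> (\<lambda>n. uniform_kernel \<mu> (\<Phi> n)) ?q C"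
  proof unfold_locales
    fix n i j :: nat and g k :: 'g
    show "integrable \<mu> (uniform_kernel \<mu> (\<Phi> n))" by (rule integrable_uniform_kernel[OF \<Phi>(1,2)])
    show "0 \<le> uniform_kernel \<mu> (\<Phi> n) g" by (simp add: uniform_kernel_def)
    show "(\<integral>g. uniform_kernel \<mu> (\<Phi> n) g \<partial>\<mu>) = 1"
      using \<Phi>(3)[of n] by (simp add: uniform_kernel_def)
    show "integrable \<mu> (?q n)" using \<Psi>(1) fin by (intro integrable_divide) auto
    show "0 \<le> ?q n g" by simp
    show "(\<integral>g. ?q n g \<partial>\<mu>) \<le> C"
      using mass[of n] \<Phi>(3)[of n] by (simp add: field_simps)
    assume "i < j" "uniform_kernel \<mu> (\<Phi> i) g \<noteq> 0"
    then have "k \<in> \<Phi> j \<Longrightarrow> - g + k \<in> (\<Union>i<j. inv_prod (\<Phi> i) (\<Phi> j))"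
      by (auto simp: uniform_kernel_def inv_prod_def indicator_def split: if_splits)
    then have "k \<in> \<Phi> j \<Longrightarrow> - g + k \<in> \<Psi> j" using \<Psi>(2) by blast
    then show "uniform_kernel \<mu> (\<Phi> j) k \<le> ?q j (- g + k)"
      by (auto simp: uniform_kernel_def indicator_def divide_right_mono)
  qed
  then show ?thesis by blast
qed

text \<open>
  It is a.e. in \<open>a\<close>, not everywhere, that \<open>c(ga)\<close> and \<open>c'(ga)\<close> agree for almost all \<open>g\<close>: for fixed
  \<open>g\<close> left invariance makes the exceptional \<open>a\<close> a null set, and Fubini exchanges the quantifiers. For every
  \<open>a\<close> one would need that right translations preserve null sets.
\<close>

lemma (in haar_action) correlation_AE_cong:
  fixes c c' :: "'g \<Rightarrow> real" and A :: "nat \<Rightarrow> 'g set"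
  assumes [measurable]: "c \<in> borel_measurable \<mu>" "c' \<in> borel_measurable \<mu>" "\<And>n. A n \<in> sets \<mu>"
    and eq: "AE g in \<mu>. c g = c' g"
  shows "AE a in \<mu>. \<forall>n. (\<integral>g. uniform_kernel \<mu> (A n) g * (c g * c (g + a)) \<partial>\<mu>)
            = (\<integral>g. uniform_kernel \<mu> (A n) g * (c' g * c' (g + a)) \<partial>\<mu>)"
proof -
  have [measurable]: "uniform_kernel \<mu> (A n) \<in> borel_measurable \<mu>" for n
    unfolding uniform_kernel_def by measurable
  have "AE a in \<mu>. c (g + a) = c' (g + a)" for g
  proof -
    have "AE a in distr \<mu> \<mu> ((+) g). c a = c' a" unfolding left_haar_distr[OF haar] by (rule eq)
    then show ?thesis by (subst (asm) AE_distr_iff) auto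
  qed
  then have "AE g in \<mu>. AE a in \<mu>. c (g + a) = c' (g + a)" by simp
  then have "AE a in \<mu>. AE g in \<mu>. c (g + a) = c' (g + a)"
    by (subst GG.AE_commute) auto
  then show ?thesis
  proof eventually_elim
    case (elim a)
    have "(\<integral>g. uniform_kernel \<mu> (A n) g * (c g * c (g + a)) \<partial>\<mu>)
            = (\<integral>g. uniform_kernel \<mu> (A n) g * (c' g * c' (g + a)) \<partial>\<mu>)" for n
      by (rule integral_cong_AE) (use elim eq in auto)
    then show ?case by blast
  qed
qed

lemma (in haar_action) AE_orbit:
  assumes [measurable]: "Measurable.pred M P" and P: "AE x in M. P x"
  shows "AE x in M. AE g in \<mu>. P (act g x)"
proof -
  have "AE x in M. P (act g x)" for g
  proof -
    have "AE x in distr M M (act g). P x" unfolding act_preserving by (rule P)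
    then show ?thesis by (subst (asm) AE_distr_iff) auto
  qed
  then have "AE g in \<mu>. AE x in M. P (act g x)" by simp
  then show ?thesis by (subst GX.AE_commute[symmetric]) auto
qed

text \<open>
  Changing \<open>c\<close> on a null set changes the set of good shifts only by a null set, which densities ignore. So the
  bound \<open>\<bar>c\<bar> \<le> 1\<close>, given almost everywhere, may be assumed everywhere.
\<close>

lemma (in haar_action) self_orthogonal_uniform:
  fixes c :: "'g \<Rightarrow> real"
  assumes folner: "strong_folner \<mu> \<Phi>" and tempered: "tempered \<mu> \<Phi>"
    and c [measurable]: "c \<in> borel_measurable \<mu>" and c': "c' \<in> borel_measurable \<mu>" "\<And>g. \<bar>c' g\<bar> \<le> 1"
    and eq: "AE g in \<mu>. c g = c' g"
    and orth: "\<forall>\<delta>>0. \<exists>N\<^sub>\<delta>. \<forall>L R. N\<^sub>\<delta> \<le> L \<and> L \<le> R \<longrightarrow>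
           lower_density \<mu> \<Phi>
             {a. \<forall>n. L \<le> n \<and> n \<le> R \<longrightarrow> \<bar>average \<mu> (\<Phi> n) (\<lambda>g. c g * c (g + a))\<bar> < \<delta>}
           > ereal (1 - \<delta>)"
  shows "\<exists>q C. self_orthogonal M act \<mu> (\<lambda>n. uniform_kernel \<mu> (\<Phi> n)) q C c'"
proof -
  note \<Phi> = strong_folnerD[OF folner]
  note [measurable] = \<Phi>(1) c'(1)
  obtain q C where "tempered_kernels M act \<mu> (\<lambda>n. uniform_kernel \<mu> (\<Phi> n)) q C"
    using tempered_kernels_uniform[OF folner tempered] by blast
  then interpret K: tempered_kernels M act \<mu> "\<lambda>n. uniform_kernel \<mu> (\<Phi> n)" q C .
  let ?p = "\<lambda>n. uniform_kernel \<mu> (\<Phi> n)"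
  have [measurable]: "?p n \<in> borel_measurable \<mu>" for n unfolding uniform_kernel_def by measurable
  have "self_orthogonal M act \<mu> ?p q C c'"
  proof unfold_locales
    show "(\<lambda>n. \<integral>a. \<bar>?p n (g + a) - ?p n a\<bar> \<partial>\<mu>) \<longlonglongrightarrow> 0" for g
      by (rule strong_folner_asymptotically_invariant[OF haar folner])
    fix \<delta> :: real assume \<delta>: "0 < \<delta>"
    with orth obtain L where L: "\<And>R. L \<le> R \<Longrightarrow> lower_density \<mu> \<Phi>
             {a. \<forall>n. L \<le> n \<and> n \<le> R \<longrightarrow> \<bar>average \<mu> (\<Phi> n) (\<lambda>g. c g * c (g + a))\<bar> < \<delta>}
           > ereal (1 - \<delta>)" by (meson order_refl)
    show "\<exists>L. \<forall>R\<ge>L. \<exists>S\<in>sets \<mu>.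
          (\<forall>\<^sub>F n in sequentially. (\<integral>a. ?p n a * indicator S a \<partial>\<mu>) \<le> \<delta>) \<and>
          (\<forall>a. a \<notin> S \<longrightarrow> (\<forall>i\<in>{L..R}. \<bar>\<integral>g. ?p i g * (c' g * c' (g + a)) \<partial>\<mu>\<bar> \<le> \<delta>))"
    proof (intro exI[of _ L] allI impI)
      fix R assume "L \<le> R"
      define G where "G d = {a. \<forall>n\<in>{L..R}. \<bar>\<integral>g. ?p n g * (d g * d (g + a)) \<partial>\<mu>\<bar> < \<delta>}"
        for d :: "'g \<Rightarrow> real"
      have "{a \<in> space \<mu>. \<forall>n\<in>{L..R}. \<bar>\<integral>g. ?p n g * (d g * d (g + a)) \<partial>\<mu>\<bar> < \<delta>} \<in> sets \<mu>"
        if [measurable]: "d \<in> borel_measurable \<mu>" for d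
        by measurable
      then have G_sets: "G d \<in> sets \<mu>" if "d \<in> borel_measurable \<mu>" for d
        using that by (simp add: G_def)
      note [measurable] = G_sets[OF c] G_sets[OF c'(1)]
      have G_eq: "measure \<mu> (G c \<inter> \<Phi> n) = measure \<mu> (G c' \<inter> \<Phi> n)" for n
      proof (rule measure_eq_AE)
        show "AE a in \<mu>. (a \<in> G c \<inter> \<Phi> n) = (a \<in> G c' \<inter> \<Phi> n)"
          using correlation_AE_cong[OF c c'(1) _ eq, of \<Phi>, OF \<Phi>(1)] by eventually_elim (simp add: G_def)
      qed auto
      have "ereal (1 - \<delta>) < liminf (\<lambda>n. ereal (measure \<mu> (G c \<inter> \<Phi> n) / measure \<mu> (\<Phi> n)))"
        using L[OF \<open>L \<le> R\<close>]
        by (simp add: lower_density_def G_def average_eq_uniform_kernel Ball_def)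
      then have ev: "\<forall>\<^sub>F n in sequentially. 1 - \<delta> < measure \<mu> (G c \<inter> \<Phi> n) / measure \<mu> (\<Phi> n)"
        by (auto dest: less_LiminfD)
      have "\<forall>\<^sub>F n in sequentially. (\<integral>a. ?p n a * indicator (- G c') a \<partial>\<mu>) \<le> \<delta>"
        using ev
      proof eventually_elim
        case (elim n)
        have "(\<integral>a. ?p n a * indicator (- G c') a \<partial>\<mu>) = (\<integral>a. ?p n a - indicator (G c' \<inter> \<Phi> n) a / measure \<mu> (\<Phi> n) \<partial>\<mu>)"
          by (rule Bochner_Integration.integral_cong) (auto simp: uniform_kernel_def indicator_def)
        also have "\<dots> = 1 - measure \<mu> (G c' \<inter> \<Phi> n) / measure \<mu> (\<Phi> n)"
        proof -
          have "emeasure \<mu> (G c' \<inter> \<Phi> n) < \<infinity>"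
            using \<Phi>(2)[of n] emeasure_mono[of "G c' \<inter> \<Phi> n" "\<Phi> n" \<mu>] by (auto intro: le_less_trans)
          then have "integrable \<mu> (\<lambda>a. indicator (G c' \<inter> \<Phi> n) a / measure \<mu> (\<Phi> n))"
            by (intro integrable_divide) auto
          then show ?thesis using K.p_integrable[of n] K.p_mass[of n] by simp
        qed
        also have "\<dots> \<le> \<delta>" using elim by (simp add: G_eq)
        finally show ?case .
      qed
      moreover have "- G c' \<in> sets \<mu>"
        using sets.compl_sets[OF G_sets[OF c'(1)]] by (simp add: Compl_eq_Diff_UNIV)
      ultimately show "\<exists>S\<in>sets \<mu>.
          (\<forall>\<^sub>F n in sequentially. (\<integral>a. ?p n a * indicator S a \<partial>\<mu>) \<le> \<delta>) \<and>
          (\<forall>a. a \<notin> S \<longrightarrow> (\<forall>i\<in>{L..R}. \<bar>\<integral>g. ?p i g * (c' g * c' (g + a)) \<partial>\<mu>\<bar> \<le> \<delta>))"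
        by (intro bexI[of _ "- G c'"]) (auto simp: G_def intro: less_imp_le)
    qed
  qed (use c' in auto)
  then show ?thesis by blast
qed

section \<open>Almost everywhere convergence\<close>

theorem theorem5p2:
  fixes \<mu> :: "'g::{topological_group_add, second_countable_topology, t2_space} measure"
    and \<Phi> :: "nat \<Rightarrow> 'g set"
    and c :: "'g \<Rightarrow> real"
    and M :: "'x measure"
    and act :: "'g \<Rightarrow> 'x \<Rightarrow> 'x"
    and f :: "'x \<Rightarrow> complex"
  assumes "locally_compact_space (euclidean :: 'g topology)"
    and "left_haar_measure \<mu>"
    and "amenable \<mu>"
    and "strong_folner \<mu> \<Phi>"
    and "tempered \<mu> \<Phi>"
    and "c \<in> Linfty \<mu>"
    and "AE g in \<mu>. \<bar>c g\<bar> \<le> 1"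
    and "\<forall>\<delta>>0. \<exists>N\<^sub>\<delta>. \<forall>L R. N\<^sub>\<delta> \<le> L \<and> L \<le> R \<longrightarrow>
           lower_density \<mu> \<Phi>
             {a. \<forall>n. L \<le> n \<and> n \<le> R \<longrightarrow> \<bar>average \<mu> (\<Phi> n) (\<lambda>g. c g * c (g + a))\<bar> < \<delta>}
           > ereal (1 - \<delta>)"
    and "ergodic_mp_system M act"
    and "f \<in> Linfty M"
  shows "AE x in M. (\<lambda>N. average \<mu> (\<Phi> N) (\<lambda>g. complex_of_real (c g) * f (act g x))) \<longlonglongrightarrow> 0"
proof -
  interpret haar_action M act \<mu>
  proof (intro haar_action.intro haar_action_axioms.intro)
    show "mp_system M act" using assms(9) by (simp add: ergodic_mp_system_def)
    show "left_haar_measure \<mu>" by fact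
    show "sigma_finite_measure \<mu>" by (rule left_haar_sigma_finite) fact+
  qed
  have c [measurable]: "c \<in> borel_measurable \<mu>" using assms(6) by (simp add: Linfty_def)
  \<comment> \<open>Truncation makes the a.e. bounds on \<open>c\<close> and \<open>f\<close> hold everywhere.\<close>
  define c' where "c' g = max (- 1) (min 1 (c g))" for g
  have c' [measurable]: "c' \<in> borel_measurable \<mu>" unfolding c'_def by measurable
  have c'1: "\<bar>c' g\<bar> \<le> 1" for g by (auto simp: c'_def)
  have cc': "AE g in \<mu>. c g = c' g" using assms(7) by eventually_elim (auto simp: c'_def)
  obtain q C where "self_orthogonal M act \<mu> (\<lambda>n. uniform_kernel \<mu> (\<Phi> n)) q C c'"
    using self_orthogonal_uniform[OF assms(4,5) c c' c'1 cc' assms(8)] by blast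
  then interpret O: self_orthogonal M act \<mu> "\<lambda>n. uniform_kernel \<mu> (\<Phi> n)" q C c' .
  note [measurable] = strong_folnerD(1)[OF assms(4)]

  obtain B where f [measurable]: "f \<in> borel_measurable M" and B: "AE x in M. norm (f x) \<le> B"
    using assms(10) by (auto simp: Linfty_def)
  define f' where "f' x = (if norm (f x) \<le> B then f x else 0)" for x
  have [measurable]: "f' \<in> borel_measurable M" unfolding f'_def by measurable
  have f'_le: "norm (f' x) \<le> \<bar>B\<bar>" for x by (auto simp: f'_def)
  have Re: "bdd \<bar>B\<bar> (\<lambda>x. Re (f' x))" and Im: "bdd \<bar>B\<bar> (\<lambda>x. Im (f' x))"
    using f'_le order_trans[OF abs_Re_le_cmod] order_trans[OF abs_Im_le_cmod]
    by (auto simp: bdd_def)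
  have ff': "AE x in M. AE g in \<mu>. f (act g x) = f' (act g x)"
    using B by (intro AE_orbit) (auto simp: f'_def)
  show ?thesis
    using O.weighted_averages_tendsto_0[OF Re] O.weighted_averages_tendsto_0[OF Im] ff' AE_space
  proof eventually_elim
    case (elim x)
    have [measurable]: "(\<lambda>g. f (act g x)) \<in> borel_measurable \<mu>" "(\<lambda>g. f' (act g x)) \<in> borel_measurable \<mu>"
      using elim(4) by measurable
    have "average \<mu> (\<Phi> N) (\<lambda>g. complex_of_real (c g) * f (act g x))
        = complex_of_real (pull (O.pc N) (\<lambda>x. Re (f' x)) x)
          + \<i> * complex_of_real (pull (O.pc N) (\<lambda>x. Im (f' x)) x)" for N
    proof -
      note int = integrable_pull[OF O.pc_integrable Re elim(4), of N]
        integrable_pull[OF O.pc_integrable Im elim(4), of N]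
      have "average \<mu> (\<Phi> N) (\<lambda>g. complex_of_real (c g) * f (act g x))
          = (\<integral>g. uniform_kernel \<mu> (\<Phi> N) g *\<^sub>R (complex_of_real (c g) * f (act g x)) \<partial>\<mu>)"
        by (simp add: average_def set_lebesgue_integral_def uniform_kernel_def
            integral_scaleR_right[symmetric] del: integral_scaleR_right)
      also have "\<dots> = (\<integral>g. complex_of_real (O.pc N g * Re (f' (act g x)))
          + \<i> * complex_of_real (O.pc N g * Im (f' (act g x))) \<partial>\<mu>)"
      proof (rule integral_cong_AE)
        show "AE g in \<mu>. uniform_kernel \<mu> (\<Phi> N) g *\<^sub>R (complex_of_real (c g) * f (act g x))
            = complex_of_real (O.pc N g * Re (f' (act g x)))
              + \<i> * complex_of_real (O.pc N g * Im (f' (act g x)))"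
          using cc' elim(3) by eventually_elim (simp add: O.pc_def complex_eq_iff)
        show "(\<lambda>g. uniform_kernel \<mu> (\<Phi> N) g *\<^sub>R (complex_of_real (c g) * f (act g x))) \<in> borel_measurable \<mu>"
          unfolding uniform_kernel_def by measurable
      qed (unfold O.pc_def uniform_kernel_def, measurable)
      also have "\<dots> = complex_of_real (pull (O.pc N) (\<lambda>x. Re (f' x)) x)
          + \<i> * complex_of_real (pull (O.pc N) (\<lambda>x. Im (f' x)) x)"
        unfolding pull_def using int
        by (subst Bochner_Integration.integral_add)
           (simp_all del: of_real_mult add: integral_complex_of_real integrable_of_real)
      finally show ?thesis .
    qed
    moreover have "(\<lambda>N. complex_of_real (pull (O.pc N) (\<lambda>x. Re (f' x)) x)
          + \<i> * complex_of_real (pull (O.pc N) (\<lambda>x. Im (f' x)) x)) \<longlonglongrightarrow> of_real 0 + \<i> * of_real 0"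
      by (intro tendsto_intros elim)
    ultimately show ?case by simp
  qed
qed

end
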